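(* Let $\epsilon_0>0$ be fixed, and let $K=K_n\ge2$, $a=a_n$, $b=b_n$ satisfy $\epsilon_0<b<a$, $a/n<1-\epsilon_0$. Let $\eta_n\to0$ be a sequence with $\eta_n\ge 2K/n$. If $\frac{nI}{K}\to\infty$, then $$\inf_{\hat\sigma}\sup_{\sigma\in\Theta^0(n,K,a,b)}\mathbb{E}\, r(\sigma,\hat\sigma)\ge \exp\Big(-(1+o(1))\frac{nI}{K}\Big).$$ If $\frac{nI}{K}=O(1)$, then $\inf_{\hat\sigma}\sup_{\sigma\in\Theta^0(n,K,a,b)}\mathbb{E}\, r(\sigma,\hat\sigma)\ge c$ for some constant $c>0$ not depending on $n$.
   Context: SBM: for an assignment $\sigma:[n]\to[K]$ (community sizes $n_k=|\{i:\sigma(i)=k\}|$) and probabilities $\{\theta_{i,j}\}$, one observes a symmetric $A\in\{0,1\}^{n\times n}$ with $A_{i,i}=0$ and independent $A_{i,j}\sim\mathrm{Ber}(\theta_{i,j})$, $i<j$. The approximately equal-size homogeneous space $\Theta^0(n,K,a,b)$ (with tolerance sequence $\eta_n\to 0$) is the set of assignments $\sigma:[n]\to[K]$ with $n_k\in[(1-\eta_n)\frac nK,(1+\eta_n)\frac nK]$ for all $k$, together with $\theta_{i,j}=a/n$ if $\sigma(i)=\sigma(j)$, $\theta_{i,j}=b/n$ if $\sigma(i)\ne\sigma(j)$ ($i\neq j$), $\theta_{i,i}=0$. $I=-2\log\big(\sqrt{\frac{a}{n}\frac{b}{n}}+\sqrt{(1-\frac{a}{n})(1-\frac{b}{n})}\big)$.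 Mis-match ratio $r(\sigma,\hat\sigma)=\min_\delta d_H(\sigma,\delta\circ\hat\sigma)/n$ over permutations $\delta$ of $[K]$, $d_H$ the Hamming distance. Infimum over all (possibly randomized) estimators. "$\exp(-(1+o(1))G)$" means $\exp(-(1+\delta_n)G)$ for some sequence $\delta_n\to0$. *)

theory Defs
  imports "HOL-Probability.Probability" "HOL-Combinatorics.Permutations" "HOL-Library.Landau_Symbols"
begin

definition assignments :: "nat \<Rightarrow> nat \<Rightarrow> (nat \<Rightarrow> nat) set" where
  "assignments n K = {..<n} \<rightarrow>\<^sub>E {..<K}"

text \<open>Approximately equal-size homogeneous space (the probabilities are determined by sigma, a, b).\<close>
definition Theta0 :: "nat \<Rightarrow> nat \<Rightarrow> real \<Rightarrow> (nat \<Rightarrow> nat) set" where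
  "Theta0 n K eta = {\<sigma> \<in> assignments n K. \<forall>k<K.
      (1 - eta) * real n / real K \<le> real (card {i\<in>{..<n}. \<sigma> i = k}) \<and>
      real (card {i\<in>{..<n}. \<sigma> i = k}) \<le> (1 + eta) * real n / real K}"

definition pairs :: "nat \<Rightarrow> (nat \<times> nat) set" where
  "pairs n = {(i, j). i < j \<and> j < n}"

definition edge_prob :: "nat \<Rightarrow> real \<Rightarrow> real \<Rightarrow> (nat \<Rightarrow> nat) \<Rightarrow> nat \<times> nat \<Rightarrow> real" where
  "edge_prob n a b \<sigma> p = (if \<sigma> (fst p) = \<sigma> (snd p) then a / real n else b / real n)"

definition graph_prob :: "nat \<Rightarrow> real \<Rightarrow> real \<Rightarrow> (nat \<Rightarrow> nat) \<Rightarrow> (nat \<times> nat) set \<Rightarrow> real" where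
  "graph_prob n a b \<sigma> E =
     (\<Prod>p\<in>pairs n. if p \<in> E then edge_prob n a b \<sigma> p else 1 - edge_prob n a b \<sigma> p)"

definition mismatch :: "nat \<Rightarrow> nat \<Rightarrow> (nat \<Rightarrow> nat) \<Rightarrow> (nat \<Rightarrow> nat) \<Rightarrow> real" where
  "mismatch n K \<sigma> \<tau> =
     Min {real (card {i\<in>{..<n}. \<sigma> i \<noteq> \<delta> (\<tau> i)}) / real n | \<delta>. \<delta> permutes {..<K}}"

definition estimators :: "nat \<Rightarrow> nat \<Rightarrow> ((nat \<times> nat) set \<Rightarrow> (nat \<Rightarrow> nat) pmf) set" where
  "estimators n K = {est. \<forall>E. set_pmf (est E) \<subseteq> assignments n K}"

definition risk :: "nat \<Rightarrow> nat \<Rightarrow> real \<Rightarrow> real \<Rightarrow> ((nat \<times> nat) set \<Rightarrow> (nat \<Rightarrow> nat) pmf)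
                     \<Rightarrow> (nat \<Rightarrow> nat) \<Rightarrow> real" where
  "risk n K a b est \<sigma> =
     (\<Sum>E\<in>Pow (pairs n). graph_prob n a b \<sigma> E *
        measure_pmf.expectation (est E) (\<lambda>\<tau>. mismatch n K \<sigma> \<tau>))"

definition minimax_risk :: "nat \<Rightarrow> nat \<Rightarrow> real \<Rightarrow> real \<Rightarrow> real \<Rightarrow> real" where
  "minimax_risk n K a b eta =
     (INF est\<in>estimators n K. SUP \<sigma>\<in>Theta0 n K eta. risk n K a b est \<sigma>)"

definition I_div :: "nat \<Rightarrow> real \<Rightarrow> real \<Rightarrow> real" where
  "I_div n a b = -2 * ln (sqrt (a / real n * (b / real n)) + sqrt ((1 - a / real n) * (1 - b / real n)))"

end

theory Submission
  imports Defs
begin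

text \<open>A two-point testing bound, combined with a prior under which a constant fraction of the
  nodes is individually ambiguous.

  Communities are grouped in pairs. Away from a pool of nodes the assignment is fixed; inside the
  pool each node carries one of the two labels of its pair, subject to the constraint that the first
  label is used \<open>u - 1\<close> or \<open>u\<close> times per pair. This leaves all community sizes within two of
  \<open>n / K\<close>, and yet under every such assignment at least half of the pool can switch to the partner
  label without leaving the prior (which half depends on the assignment). Since outside the pool
  the labels are known and each community is mostly outside, the minimum over label permutations
  in the mismatch ratio costs only a factor 2 (by projecting the estimate to the prior).

  Deciding whether a single node switches is a test between two product Bernoulli measures that
  differ in about \<open>2 n / K\<close> coordinates. Writing both as tilts of their normalised geometric mean
  by \<open>exp (L / 2)\<close> and \<open>exp (- L / 2)\<close>, the total overlap is \<open>Z * E (exp (- \<bar>L\<bar> / 2))\<close>, where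
  \<open>Z\<close> is the Hellinger affinity (about \<open>exp (- n I / K)\<close>). By Jensen's inequality the
  expectation costs only \<open>exp (- O (sqrt (n I / K)))\<close>, because the second moment of \<open>L\<close> is
  \<open>O (n I / K)\<close>.\<close>

subsection \<open>Overlap of product Bernoulli measures\<close>

definition bern_prod :: "('a \<Rightarrow> real) \<Rightarrow> 'a set \<Rightarrow> 'a set \<Rightarrow> real" where
  "bern_prod f S E = (\<Prod>p\<in>S. if p \<in> E then f p else 1 - f p)"

text \<open>For \<open>x p = ln (f p / g p)\<close> and
  \<open>y p = ln ((1 - f p) / (1 - g p))\<close> this is the log-likelihood ratio of
  \<open>bern_prod f\<close> against \<open>bern_prod g\<close> at \<open>E\<close>.\<close>

definition log_lik :: "('a \<Rightarrow> real) \<Rightarrow> ('a \<Rightarrow> real) \<Rightarrow> 'a set \<Rightarrow> 'a set \<Rightarrow> real" where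
  "log_lik x y S E = (\<Sum>p\<in>S. if p \<in> E then x p else y p)"

lemma sum_Pow_insert:
  assumes "finite S" "z \<notin> S"
  shows "(\<Sum>E\<in>Pow (insert z S). \<Phi> E) = (\<Sum>E\<in>Pow S. \<Phi> E + \<Phi> (insert z E))"
proof -
  have "inj_on (insert z) (Pow S)" "Pow S \<inter> insert z ` Pow S = {}"
    using assms(2) by (auto simp: inj_on_def)
  then show ?thesis
    using assms(1) by (simp add: Pow_insert sum.union_disjoint sum.reindex sum.distrib)
qed

lemma
  assumes "finite S" "z \<notin> S" "E \<subseteq> S"
  shows bern_prod_insert: "bern_prod f (insert z S) E = (1 - f z) * bern_prod f S E"
      "bern_prod f (insert z S) (insert z E) = f z * bern_prod f S E"
    and log_lik_insert: "log_lik x y (insert z S) E = y z + log_lik x y S E"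
      "log_lik x y (insert z S) (insert z E) = x z + log_lik x y S E"
proof -
  have "z \<notin> E" using assms by auto
  moreover have "(\<Prod>p\<in>S. if p \<in> insert z E then f p else 1 - f p) = (\<Prod>p\<in>S. if p \<in> E then f p else 1 - f p)"
    "(\<Sum>p\<in>S. if p \<in> insert z E then x p else y p) = (\<Sum>p\<in>S. if p \<in> E then x p else y p)"
    using assms by (auto intro!: prod.cong sum.cong)
  ultimately show "bern_prod f (insert z S) E = (1 - f z) * bern_prod f S E"
      "bern_prod f (insert z S) (insert z E) = f z * bern_prod f S E"
      "log_lik x y (insert z S) E = y z + log_lik x y S E"
      "log_lik x y (insert z S) (insert z E) = x z + log_lik x y S E"
    using assms by (auto simp: bern_prod_def log_lik_def)
qed

lemma bern_prod_total:
  assumes "finite S"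
  shows "(\<Sum>E\<in>Pow S. bern_prod t S E) = 1"
  using assms
proof induction
  case (insert z S)
  have "(\<Sum>E\<in>Pow (insert z S). bern_prod t (insert z S) E) = (\<Sum>E\<in>Pow S. bern_prod t S E)"
    unfolding sum_Pow_insert[OF insert(1,2)]
    by (intro sum.cong) (auto simp: bern_prod_insert insert algebra_simps)
  then show ?case using insert by simp
qed (simp add: bern_prod_def)

lemma log_lik_mean:
  assumes "finite S"
  shows "(\<Sum>E\<in>Pow S. bern_prod t S E * log_lik x y S E) = (\<Sum>p\<in>S. t p * x p + (1 - t p) * y p)"
  using assms
proof induction
  case (insert z S)
  have "(\<Sum>E\<in>Pow (insert z S). bern_prod t (insert z S) E * log_lik x y (insert z S) E)
      = (\<Sum>E\<in>Pow S. bern_prod t S E * (t z * x z + (1 - t z) * y z)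
            + bern_prod t S E * log_lik x y S E)"
    unfolding sum_Pow_insert[OF insert(1,2)]
    by (intro sum.cong) (auto simp: bern_prod_insert log_lik_insert insert algebra_simps)
  then show ?case using insert
    by (simp add: sum.distrib sum_distrib_right[symmetric] bern_prod_total)
qed (simp add: log_lik_def)

text \<open>Coordinates are independent under \<open>bern_prod t\<close>, so their variances add up.
  The squared mean is kept apart because it nearly cancels in the application.\<close>

lemma log_lik_second_moment:
  assumes "finite S"
  shows "(\<Sum>E\<in>Pow S. bern_prod t S E * (log_lik x y S E)\<^sup>2)
     = (\<Sum>p\<in>S. t p * (x p)\<^sup>2 + (1 - t p) * (y p)\<^sup>2 - (t p * x p + (1 - t p) * y p)\<^sup>2)
       + (\<Sum>p\<in>S. t p * x p + (1 - t p) * y p)\<^sup>2"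
  using assms
proof induction
  case (insert z S)
  let ?m = "t z * x z + (1 - t z) * y z"
  \<comment> \<open>\<open>w\<close> and \<open>m\<close> stand for the second moment and the mean
    of the new coordinate, \<open>V\<close> and \<open>M\<close> for the variance and the mean of
    the rest.\<close>
  have square: "w + M * (2 * m) + (V + M\<^sup>2) = (w - m\<^sup>2 + V) + (m + M)\<^sup>2" for w m M V :: real
    by (simp add: power2_eq_square algebra_simps)
  have "(\<Sum>E\<in>Pow (insert z S). bern_prod t (insert z S) E * (log_lik x y (insert z S) E)\<^sup>2)
      = (\<Sum>E\<in>Pow S. bern_prod t S E * (t z * (x z)\<^sup>2 + (1 - t z) * (y z)\<^sup>2)
            + bern_prod t S E * log_lik x y S E * (2 * ?m)
            + bern_prod t S E * (log_lik x y S E)\<^sup>2)"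
    unfolding sum_Pow_insert[OF insert(1,2)]
    by (intro sum.cong) (auto simp: bern_prod_insert log_lik_insert insert algebra_simps power2_eq_square)
  also have "\<dots> = (t z * (x z)\<^sup>2 + (1 - t z) * (y z)\<^sup>2)
      + (\<Sum>p\<in>S. t p * x p + (1 - t p) * y p) * (2 * ?m)
      + (\<Sum>E\<in>Pow S. bern_prod t S E * (log_lik x y S E)\<^sup>2)"
    using insert(1)
    by (simp only: sum.distrib sum_distrib_right[symmetric] bern_prod_total log_lik_mean) simp
  also have "\<dots> = (\<Sum>p\<in>insert z S. t p * (x p)\<^sup>2 + (1 - t p) * (y p)\<^sup>2
        - (t p * x p + (1 - t p) * y p)\<^sup>2)
       + (\<Sum>p\<in>insert z S. t p * x p + (1 - t p) * y p)\<^sup>2"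
    unfolding insert.IH sum.insert[OF insert(1,2)] by (rule square)
  finally show ?case .
qed (simp add: log_lik_def)

section \<open>Hellinger affinity and tilts of the geometric mean\<close>

definition affinity :: "real \<Rightarrow> real \<Rightarrow> real" where
  "affinity p q = sqrt (p * q) + sqrt ((1 - p) * (1 - q))"

text \<open>The pointwise geometric mean of Ber(p) and Ber(q) has total mass
  \<open>affinity p q\<close>; normalised, it is again Bernoulli, with this success
  probability.\<close>

definition tilt :: "real \<Rightarrow> real \<Rightarrow> real" where
  "tilt p q = sqrt (p * q) / affinity p q"

lemma affinity_pos: "0 < p \<Longrightarrow> p < 1 \<Longrightarrow> 0 < q \<Longrightarrow> q < 1 \<Longrightarrow> 0 < affinity p q"
  by (simp add: affinity_def add_pos_pos)

lemma affinity_commute: "affinity p q = affinity q p"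
  by (simp add: affinity_def mult.commute)

lemma tilt_commute: "tilt p q = tilt q p"
  by (simp add: tilt_def affinity_commute mult.commute)

lemma affinity_self: "0 < p \<Longrightarrow> p < 1 \<Longrightarrow> affinity p p = 1"
  by (simp add: affinity_def)

lemma one_minus_tilt:
  assumes "0 < p" "p < 1" "0 < q" "q < 1"
  shows "1 - tilt p q = sqrt ((1 - p) * (1 - q)) / affinity p q"
proof -
  have "1 - tilt p q = (affinity p q - sqrt (p * q)) / affinity p q"
    using affinity_pos[OF assms] by (simp add: tilt_def diff_divide_distrib)
  then show ?thesis by (simp add: affinity_def)
qed

lemma sqrt_mult_exp_ln_ratio:
  assumes "0 < x" "0 < (y::real)"
  shows "sqrt (x * y) * exp (ln (x / y) / 2) = x"
proof -
  have "exp (ln (x / y) / 2) = sqrt (x / y)"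
    using assms by (subst ln_sqrt[symmetric]) (auto intro: exp_ln)
  then show ?thesis using assms by (simp add: real_sqrt_mult real_sqrt_divide)
qed

text \<open>Coordinatewise, \<open>f = sqrt (f * g) * sqrt (f / g)\<close>: the first factor is the
  affinity times the tilted law, the second the exponential of half the log ratio.\<close>

lemma bern_prod_tilt:
  assumes "finite S" and fg: "\<And>p. p \<in> S \<Longrightarrow> 0 < f p \<and> f p < 1 \<and> 0 < g p \<and> g p < 1"
  shows "bern_prod f S E = (\<Prod>p\<in>S. affinity (f p) (g p)) * bern_prod (\<lambda>p. tilt (f p) (g p)) S E *
     exp (log_lik (\<lambda>p. ln (f p / g p)) (\<lambda>p. ln ((1 - f p) / (1 - g p))) S E / 2)"
proof -
  have "bern_prod f S E = (\<Prod>p\<in>S. affinity (f p) (g p) *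
        (if p \<in> E then tilt (f p) (g p) else 1 - tilt (f p) (g p)) *
        exp ((if p \<in> E then ln (f p / g p) else ln ((1 - f p) / (1 - g p))) / 2))"
    unfolding bern_prod_def
  proof (intro prod.cong refl)
    fix p assume "p \<in> S"
    from fg[OF this] affinity_pos[of "f p" "g p"]
      sqrt_mult_exp_ln_ratio[of "f p" "g p"] sqrt_mult_exp_ln_ratio[of "1 - f p" "1 - g p"]
    show "(if p \<in> E then f p else 1 - f p) = affinity (f p) (g p) *
        (if p \<in> E then tilt (f p) (g p) else 1 - tilt (f p) (g p)) *
        exp ((if p \<in> E then ln (f p / g p) else ln ((1 - f p) / (1 - g p))) / 2)"
      by (simp add: one_minus_tilt) (simp add: tilt_def)
  qed
  then show ?thesis
    by (simp add: prod.distrib bern_prod_def log_lik_def exp_sum assms(1) sum_divide_distrib)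
qed

lemma tilt_bounds: "0 < p \<Longrightarrow> p < 1 \<Longrightarrow> 0 < q \<Longrightarrow> q < 1 \<Longrightarrow> 0 \<le> tilt p q \<and> tilt p q \<le> 1"
  using affinity_pos[of p q] by (auto simp: tilt_def affinity_def)

lemma sum_min_bern_prod_ge:
  fixes f g :: "'a \<Rightarrow> real"
  defines "t \<equiv> \<lambda>p. tilt (f p) (g p)"
    and "x \<equiv> \<lambda>p. ln (f p / g p)" and "y \<equiv> \<lambda>p. ln ((1 - f p) / (1 - g p))"
  assumes fin: "finite S" and fg: "\<And>p. p \<in> S \<Longrightarrow> 0 < f p \<and> f p < 1 \<and> 0 < g p \<and> g p < 1"
    and v: "(\<Sum>E\<in>Pow S. bern_prod t S E * (log_lik x y S E)\<^sup>2) \<le> v"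
  shows "(\<Sum>E\<in>Pow S. min (bern_prod f S E) (bern_prod g S E))
     \<ge> (\<Prod>p\<in>S. affinity (f p) (g p)) * exp (- sqrt v / 2)"
proof -
  define Z where "Z = (\<Prod>p\<in>S. affinity (f p) (g p))"
  let ?L = "log_lik x y S" and ?w = "bern_prod t S"
  have Z: "0 \<le> Z"
    unfolding Z_def using fg by (intro prod_nonneg) (auto intro!: less_imp_le affinity_pos)
  have w: "0 \<le> ?w E" for E
    unfolding bern_prod_def t_def using fg tilt_bounds by (intro prod_nonneg) auto
  have f_eq: "bern_prod f S E = Z * ?w E * exp (?L E / 2)" for E
    using bern_prod_tilt[OF fin fg] by (simp add: Z_def t_def x_def y_def)
  \<comment> \<open>Exchanging \<open>f\<close> and \<open>g\<close> negates the log-likelihood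
    ratio and keeps affinity and tilt, so \<open>g\<close> is the opposite tilt of the same
    law.\<close>
  have neg: "log_lik (\<lambda>p. ln (g p / f p)) (\<lambda>p. ln ((1 - g p) / (1 - f p))) S E = - ?L E" for E
    unfolding log_lik_def x_def y_def sum_negf[symmetric]
    using fg by (intro sum.cong) (auto simp: ln_div)
  have g_eq: "bern_prod g S E = Z * ?w E * exp (- ?L E / 2)" for E
    using bern_prod_tilt[OF fin, of g f E] fg neg[of E]
    by (simp add: Z_def t_def affinity_commute tilt_commute)
  have min_eq: "min (bern_prod f S E) (bern_prod g S E) = Z * (?w E * exp (- \<bar>?L E\<bar> / 2))" for E
  proof (cases "?L E \<ge> 0")
    case True
    then have "bern_prod g S E \<le> bern_prod f S E"
      unfolding f_eq g_eq using Z w[of E] True by (intro mult_left_mono) auto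
    with True show ?thesis by (simp add: g_eq)
  next
    case False
    then have "bern_prod f S E \<le> bern_prod g S E"
      unfolding f_eq g_eq using Z w[of E] False by (intro mult_left_mono) auto
    with False show ?thesis by (simp add: f_eq)
  qed
  define m where "m = (\<Sum>E\<in>Pow S. ?w E * \<bar>?L E\<bar>)"
  \<comment> \<open>The variance of |L| is nonnegative, hence its mean \<open>m\<close> is at most
    the root of the second moment.\<close>
  have "0 \<le> (\<Sum>E\<in>Pow S. ?w E * (\<bar>?L E\<bar> - m)\<^sup>2)"
    using w by (intro sum_nonneg) auto
  also have "\<dots> = (\<Sum>E\<in>Pow S. ?w E * (?L E)\<^sup>2 - 2 * m * (?w E * \<bar>?L E\<bar>) + m\<^sup>2 * ?w E)"
    by (intro sum.cong) (auto simp: power2_diff algebra_simps)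
  also have "\<dots> = (\<Sum>E\<in>Pow S. ?w E * (?L E)\<^sup>2) - m\<^sup>2"
    using fin by (simp add: sum.distrib sum_subtractf sum_distrib_left[symmetric] bern_prod_total
        m_def[symmetric] power2_eq_square)
  finally have "m\<^sup>2 \<le> v" using v by linarith
  then have m: "m \<le> sqrt v" by (rule real_le_rsqrt)
  \<comment> \<open>Jensen's inequality by the tangent of \<open>exp (- z)\<close> at
    \<open>z = ?c\<close>: averaging the tangent over z = |L| / 2 gives at least
    \<open>exp (- ?c)\<close>, since the mean \<open>m / 2\<close> is at most
    \<open>?c\<close>.\<close>
  let ?c = "sqrt v / 2"
  have "exp (- ?c) \<le> exp (- ?c) * (1 + ?c - m / 2)"
    using m by simp
  also have "\<dots> = (\<Sum>E\<in>Pow S. ?w E * (exp (- ?c) * (1 + (?c - \<bar>?L E\<bar> / 2))))"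
  proof -
    have "(\<Sum>E\<in>Pow S. ?w E * (exp (- ?c) * (1 + (?c - \<bar>?L E\<bar> / 2))))
       = (\<Sum>E\<in>Pow S. exp (- ?c) * (1 + ?c) * ?w E - exp (- ?c) / 2 * (?w E * \<bar>?L E\<bar>))"
      by (intro sum.cong refl) (simp add: algebra_simps)
    also have "\<dots> = exp (- ?c) * (1 + ?c) - exp (- ?c) / 2 * m"
      using fin by (simp only: sum_subtractf sum_distrib_left[symmetric] bern_prod_total[OF fin] m_def mult_1_right)
    finally show ?thesis by (simp add: algebra_simps)
  qed
  also have "\<dots> \<le> (\<Sum>E\<in>Pow S. ?w E * exp (- \<bar>?L E\<bar> / 2))"
  proof (intro sum_mono mult_left_mono w)
    fix E
    have "exp (- ?c) * (1 + (?c - \<bar>?L E\<bar> / 2)) \<le> exp (- ?c) * exp (?c - \<bar>?L E\<bar> / 2)"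
      by (intro mult_left_mono exp_ge_add_one_self) auto
    then show "exp (- ?c) * (1 + (?c - \<bar>?L E\<bar> / 2)) \<le> exp (- \<bar>?L E\<bar> / 2)"
      by (simp add: exp_add[symmetric])
  qed
  finally have "Z * exp (- ?c) \<le> Z * (\<Sum>E\<in>Pow S. ?w E * exp (- \<bar>?L E\<bar> / 2))"
    using Z by (intro mult_left_mono) auto
  then show ?thesis
    by (simp add: min_eq sum_distrib_left Z_def)
qed

section \<open>Second moment of the log-likelihood ratio in terms of the affinity\<close>

lemma ln_squared_le:
  fixes s :: real
  assumes "0 < s"
  shows "s * (ln s)\<^sup>2 \<le> (s - 1)\<^sup>2"
proof -
  \<comment> \<open>With \<open>h = ln (sqrt s)\<close> this is |h| \<le> |sinh h|; squaring and
    multiplying by \<open>4 * s\<close> gives the claim.\<close>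
  have "\<bar>ln (sqrt s)\<bar> \<le> \<bar>(sqrt s - inverse (sqrt s)) / 2\<bar>"
    using real_le_abs_sinh[of "ln (sqrt s)"] assms by simp
  then have "(ln (sqrt s))\<^sup>2 \<le> ((sqrt s - inverse (sqrt s)) / 2)\<^sup>2"
    by (simp only: abs_le_square_iff)
  then have "s * (ln s)\<^sup>2 \<le> s * (sqrt s - inverse (sqrt s))\<^sup>2"
    using assms by (simp add: ln_sqrt power_divide)
  also have "\<dots> = (sqrt s * (sqrt s - inverse (sqrt s)))\<^sup>2"
    using assms by (simp add: power_mult_distrib)
  also have "sqrt s * (sqrt s - inverse (sqrt s)) = s - 1"
    using assms by (simp add: right_diff_distrib)
  finally show ?thesis .
qed

text \<open>The previous bound at \<open>s = sqrt x / sqrt y\<close>, scaled by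
  \<open>4 * y\<close>. The geometric mean as weight makes a large log ratio harmless.\<close>

lemma sqrt_mult_ln_squared_le:
  assumes "0 < x" "0 < (y::real)"
  shows "sqrt (x * y) * (ln (x / y))\<^sup>2 \<le> 4 * (sqrt x - sqrt y)\<^sup>2"
proof -
  let ?s = "sqrt x / sqrt y"
  have s: "0 < ?s" using assms by simp
  have "ln (x / y) = 2 * ln ?s" using assms by (simp add: ln_div ln_sqrt)
  then have "sqrt (x * y) * (ln (x / y))\<^sup>2 = 4 * y * (?s * (ln ?s)\<^sup>2)"
    using assms by (simp add: real_sqrt_mult power_mult_distrib field_simps)
  also have "\<dots> \<le> 4 * y * (?s - 1)\<^sup>2"
    using assms ln_squared_le[OF s] by (intro mult_left_mono) auto
  also have "\<dots> = 4 * (sqrt y * (?s - 1))\<^sup>2"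
    using assms by (simp add: power_mult_distrib)
  also have "sqrt y * (?s - 1) = sqrt x - sqrt y"
    using assms by (simp add: field_simps)
  finally show ?thesis .
qed

text \<open>The two squared differences of roots sum to \<open>2 * (1 - affinity p q)\<close>, a
  squared Hellinger distance. So, once the affinity is bounded away from 0, the second moment of an
  edge is at most a multiple of its contribution to the exponent.\<close>

lemma tilted_second_moment_le:
  assumes "0 < p" "p < 1" "0 < q" "q < 1"
  shows "tilt p q * (ln (p / q))\<^sup>2 + (1 - tilt p q) * (ln ((1 - p) / (1 - q)))\<^sup>2
    \<le> 8 * (1 - affinity p q) / affinity p q"
proof -
  let ?B = "affinity p q"
  have B: "0 < ?B" using affinity_pos assms by blast
  have "sqrt (p * q) * (ln (p / q))\<^sup>2 + sqrt ((1 - p) * (1 - q)) * (ln ((1 - p) / (1 - q)))\<^sup>2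
      \<le> 4 * (sqrt p - sqrt q)\<^sup>2 + 4 * (sqrt (1 - p) - sqrt (1 - q))\<^sup>2"
    using assms by (intro add_mono sqrt_mult_ln_squared_le) auto
  also have "\<dots> = 8 * (1 - ?B)"
    using assms by (simp add: power2_diff affinity_def real_sqrt_mult)
  finally have "(sqrt (p * q) * (ln (p / q))\<^sup>2 + sqrt ((1 - p) * (1 - q)) * (ln ((1 - p) / (1 - q)))\<^sup>2) / ?B
      \<le> 8 * (1 - ?B) / ?B"
    using B by (intro divide_right_mono) auto
  then show ?thesis
    using one_minus_tilt[OF assms] by (simp add: tilt_def add_divide_distrib)
qed

text \<open>On \<open>D1\<close> and \<open>D2\<close> the log ratios have opposite signs, so the
  mean of L is proportional to the imbalance \<open>card D1 - card D2\<close>. For bounded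
  \<open>r\<close> the second moment is therefore linear, not quadratic, in the number of
  informative edges.\<close>

lemma sum_min_two_valued_ge:
  fixes f g :: "'a \<Rightarrow> real"
  assumes fin: "finite S" and D: "D1 \<subseteq> S" "D2 \<subseteq> S" "D1 \<inter> D2 = {}"
    and pq: "0 < p" "p < 1" "0 < q" "q < 1"
    and D1: "\<And>e. e \<in> D1 \<Longrightarrow> f e = p \<and> g e = q"
    and D2: "\<And>e. e \<in> D2 \<Longrightarrow> f e = q \<and> g e = p"
    and D3: "\<And>e. e \<in> S - D1 - D2 \<Longrightarrow> f e = g e \<and> 0 < f e \<and> f e < 1"
    and diff: "\<bar>real (card D1) - real (card D2)\<bar> \<le> r"
    and W: "8 * (1 - affinity p q) / affinity p q \<le> W"
  shows "(\<Sum>E\<in>Pow S. min (bern_prod f S E) (bern_prod g S E))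
     \<ge> affinity p q ^ (card D1 + card D2) * exp (- sqrt ((real (card D1 + card D2) + r\<^sup>2) * W) / 2)"
proof -
  let ?w = "tilt p q * (ln (p / q))\<^sup>2 + (1 - tilt p q) * (ln ((1 - p) / (1 - q)))\<^sup>2"
  let ?m = "tilt p q * ln (p / q) + (1 - tilt p q) * ln ((1 - p) / (1 - q))"
  define t where "t = (\<lambda>p. tilt (f p) (g p))"
  define x where "x = (\<lambda>p. ln (f p / g p))"
  define y where "y = (\<lambda>p. ln ((1 - f p) / (1 - g p)))"
  have finD: "finite D1" "finite D2" using D fin by (auto intro: finite_subset)
  have fg: "0 < f e \<and> f e < 1 \<and> 0 < g e \<and> g e < 1" if "e \<in> S" for e
    using that D1 D2 D3 pq by (cases "e \<in> D1"; cases "e \<in> D2") auto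
  have split: "(\<Sum>e\<in>S. F e) = (\<Sum>e\<in>D1. F e) + (\<Sum>e\<in>D2. F e)"
    if "\<And>e. e \<in> S - D1 - D2 \<Longrightarrow> F e = 0" for F :: "'a \<Rightarrow> real"
  proof -
    have "(\<Sum>e\<in>S. F e) = (\<Sum>e\<in>D1 \<union> D2. F e)"
      using that D fin by (intro sum.mono_neutral_right) auto
    then show ?thesis using D finD by (simp add: sum.union_disjoint)
  qed
  have lnq: "ln (q / p) = - ln (p / q)" "ln ((1 - q) / (1 - p)) = - ln ((1 - p) / (1 - q))"
    using pq by (simp_all add: ln_div)
  have one: "affinity (f e) (g e) = 1" if "e \<in> S - D1 - D2" for e
    using D3[OF that] affinity_self[of "g e"] by simp
  have prodB: "(\<Prod>e\<in>S. affinity (f e) (g e)) = affinity p q ^ (card D1 + card D2)"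
  proof -
    have "(\<Prod>e\<in>S. affinity (f e) (g e)) = (\<Prod>e\<in>D1 \<union> D2. affinity (f e) (g e))"
      using D fin one by (intro prod.mono_neutral_right) auto
    also have "\<dots> = (\<Prod>e\<in>D1 \<union> D2. affinity p q)"
      using D1 D2 by (intro prod.cong) (use affinity_commute[of q p] in force)+
    finally show ?thesis using D finD by (simp add: card_Un_disjoint)
  qed
  have zero: "x e = 0" "y e = 0" if "e \<in> S - D1 - D2" for e
    using D3[OF that] by (auto simp: x_def y_def)
  have on_D1: "t e = tilt p q" "x e = ln (p / q)" "y e = ln ((1 - p) / (1 - q))" if "e \<in> D1" for e
    using D1[OF that] by (simp_all add: t_def x_def y_def)
  have on_D2: "t e = tilt p q" "x e = - ln (p / q)" "y e = - ln ((1 - p) / (1 - q))" if "e \<in> D2" for e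
    using D2[OF that] lnq tilt_commute[of q p] by (simp_all only: t_def x_def y_def)
  \<comment> \<open>A sign change leaves the variance of a coordinate alone, so \<open>D1\<close>
    and \<open>D2\<close> contribute alike.\<close>
  have "(\<Sum>e\<in>S. t e * (x e)\<^sup>2 + (1 - t e) * (y e)\<^sup>2 - (t e * x e + (1 - t e) * y e)\<^sup>2)
      = real (card D1 + card D2) * (?w - ?m\<^sup>2)"
  proof (subst split)
    have "(\<Sum>e\<in>D1. t e * (x e)\<^sup>2 + (1 - t e) * (y e)\<^sup>2 - (t e * x e + (1 - t e) * y e)\<^sup>2)
       = (\<Sum>e\<in>D1. ?w - ?m\<^sup>2)"
      by (intro sum.cong refl) (simp only: on_D1)
    moreover have "(\<Sum>e\<in>D2. t e * (x e)\<^sup>2 + (1 - t e) * (y e)\<^sup>2 - (t e * x e + (1 - t e) * y e)\<^sup>2)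
       = (\<Sum>e\<in>D2. ?w - ?m\<^sup>2)"
      by (intro sum.cong refl) (simp only: on_D2 power2_minus mult_minus_right minus_add_distrib[symmetric])
    ultimately show "(\<Sum>e\<in>D1. t e * (x e)\<^sup>2 + (1 - t e) * (y e)\<^sup>2 - (t e * x e + (1 - t e) * y e)\<^sup>2) +
      (\<Sum>e\<in>D2. t e * (x e)\<^sup>2 + (1 - t e) * (y e)\<^sup>2 - (t e * x e + (1 - t e) * y e)\<^sup>2)
       = real (card D1 + card D2) * (?w - ?m\<^sup>2)"
      by (simp add: algebra_simps)
  qed (simp add: zero)
  moreover have "(\<Sum>e\<in>S. t e * x e + (1 - t e) * y e) = (real (card D1) - real (card D2)) * ?m"
  proof (subst split)
    have "(\<Sum>e\<in>D1. t e * x e + (1 - t e) * y e) = (\<Sum>e\<in>D1. ?m)"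
      by (intro sum.cong refl) (simp only: on_D1)
    moreover have "(\<Sum>e\<in>D2. t e * x e + (1 - t e) * y e) = (\<Sum>e\<in>D2. - ?m)"
      by (intro sum.cong refl) (simp only: on_D2 mult_minus_right minus_add_distrib[symmetric])
    ultimately show "(\<Sum>e\<in>D1. t e * x e + (1 - t e) * y e) + (\<Sum>e\<in>D2. t e * x e + (1 - t e) * y e)
       = (real (card D1) - real (card D2)) * ?m"
      by (simp add: algebra_simps)
  qed (simp add: zero)
  ultimately have "(\<Sum>E\<in>Pow S. bern_prod t S E * (log_lik x y S E)\<^sup>2)
      = real (card D1 + card D2) * (?w - ?m\<^sup>2) + ((real (card D1) - real (card D2)) * ?m)\<^sup>2"
    by (simp add: log_lik_second_moment[OF fin])
  also have "\<dots> \<le> real (card D1 + card D2) * ?w + r\<^sup>2 * ?m\<^sup>2"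
  proof -
    have "(real (card D1) - real (card D2))\<^sup>2 \<le> r\<^sup>2"
      using diff by (metis abs_ge_zero power2_abs power_mono)
    then have "((real (card D1) - real (card D2)) * ?m)\<^sup>2 \<le> r\<^sup>2 * ?m\<^sup>2"
      unfolding power_mult_distrib by (intro mult_right_mono) auto
    moreover have "real (card D1 + card D2) * (?w - ?m\<^sup>2) \<le> real (card D1 + card D2) * ?w"
      by (intro mult_left_mono) auto
    ultimately show ?thesis by linarith
  qed
  also have "\<dots> \<le> real (card D1 + card D2) * ?w + r\<^sup>2 * ?w"
  proof -
    \<comment> \<open>\<open>?w\<close> and \<open>?m\<close> are the second moment and the mean of
      one coordinate, so the difference is a two-point variance.\<close>
    have "?w - ?m\<^sup>2 = tilt p q * (1 - tilt p q) * (ln (p / q) - ln ((1 - p) / (1 - q)))\<^sup>2"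
      by (simp add: power2_eq_square algebra_simps)
    also have "\<dots> \<ge> 0" using tilt_bounds[OF pq] by auto
    finally show ?thesis by (intro add_left_mono mult_left_mono) auto
  qed
  also have "\<dots> = (real (card D1 + card D2) + r\<^sup>2) * ?w" by (simp add: algebra_simps)
  also have "\<dots> \<le> (real (card D1 + card D2) + r\<^sup>2) * W"
    using tilted_second_moment_le[OF pq] W by (intro mult_left_mono) auto
  finally have "(\<Prod>e\<in>S. affinity (f e) (g e)) *
      exp (- sqrt ((real (card D1 + card D2) + r\<^sup>2) * W) / 2)
      \<le> (\<Sum>E\<in>Pow S. min (bern_prod f S E) (bern_prod g S E))"
    unfolding t_def x_def y_def by (intro sum_min_bern_prod_ge[OF fin fg]) auto
  then show ?thesis unfolding prodB .
qed


subsection \<open>A prior with ambiguous nodes\<close>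

text \<open>Each community has at least \<open>n div K - u\<close> known nodes, and
  \<open>u_le\<close> makes this at least \<open>u + 1\<close>, the largest number of pool nodes
  sharing a label. \<open>u_ge\<close> keeps the counts \<open>u - 1\<close> and \<open>u\<close>
  distinct.\<close>

locale sbm_prior =
  fixes n K u :: nat
  assumes K_ge: "2 \<le> K" and u_ge: "1 \<le> u" and u_le: "2 * u + 1 \<le> n div K"
begin

text \<open>Writing \<open>i = x * K + k\<close>, the pool holds the first \<open>u\<close> nodes of
  each residue class \<open>k\<close>. For odd \<open>K\<close> the last class has no partner and is
  left out.\<close>

definition pool :: "nat set" where
  "pool = {i. i < n \<and> i div K < u \<and> i mod K < 2 * (K div 2)}"

definition partner :: "nat \<Rightarrow> nat" where
  "partner k = (if even k then k + 1 else k - 1)"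

definition flip :: "nat \<Rightarrow> (nat \<Rightarrow> nat) \<Rightarrow> nat \<Rightarrow> nat" where
  "flip i \<sigma> = \<sigma>(i := partner (\<sigma> i))"

text \<open>Prescribing a single count per pair would forbid every flip of one node. Two consecutive
  values allow flips and hold each community within one node of its size under
  \<open>i mod K\<close>.\<close>

definition prior :: "(nat \<Rightarrow> nat) set" where
  "prior = {\<sigma> \<in> assignments n K. (\<forall>i<n. i \<notin> pool \<longrightarrow> \<sigma> i = i mod K) \<and>
     (\<forall>i\<in>pool. \<sigma> i div 2 = i mod K div 2) \<and>
     (\<forall>j<K div 2. card {i\<in>pool. \<sigma> i = 2 * j} \<in> {u - 1, u})}"

lemma partner_partner [simp]: "partner (partner k) = k"
  by (auto simp: partner_def)

lemma partner_neq [simp]: "partner k \<noteq> k"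
  by (auto simp: partner_def elim: oddE)

lemma partner_div [simp]: "partner k div 2 = k div 2"
  by (auto simp: partner_def elim!: oddE evenE)

lemma less_double_if_div_eq: "a div 2 = b div 2 \<Longrightarrow> b < 2 * m \<Longrightarrow> a < 2 * (m::nat)"
  by presburger

lemma flip_flip [simp]: "flip i (flip i \<sigma>) = \<sigma>"
  by (simp add: flip_def)

lemma finite_pool [simp]: "finite pool"
  by (rule finite_subset[of _ "{..<n}"]) (auto simp: pool_def)

lemma finite_assignments: "finite (assignments n K)"
  by (simp add: assignments_def finite_PiE)

lemma finite_prior [simp]: "finite prior"
  by (rule finite_subset[OF _ finite_assignments]) (auto simp: prior_def)

section \<open>Sizes of residue classes, pool and communities\<close>

lemma inj_mult_add: "inj_on (\<lambda>x. x * K + k) A"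
  using K_ge by (auto simp: inj_on_def)

lemma mult_div_le: "n div K * K \<le> n"
  by simp

lemma residue_class_eq: "k < K \<Longrightarrow> {i. P i \<and> i mod K = k} = (\<lambda>x. x * K + k) ` {x. P (x * K + k)}"
  by (auto simp: image_iff) (metis div_mult_mod_eq)

lemma card_residue_class:
  assumes "k < K"
  shows "n div K \<le> card {i. i < n \<and> i mod K = k}" "card {i. i < n \<and> i mod K = k} \<le> n div K + 1"
proof -
  have card: "card {i. i < n \<and> i mod K = k} = card {x. x * K + k < n}"
    unfolding residue_class_eq[OF assms] by (rule card_image[OF inj_mult_add])
  have sub: "{x. x * K + k < n} \<subseteq> {..n div K}"
  proof safe
    fix x assume "x * K + k < n"
    then have "x * K div K \<le> n div K" by (intro div_le_mono) simp
    then show "x \<le> n div K" using K_ge by simp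
  qed
  have sup: "{..<n div K} \<subseteq> {x. x * K + k < n}"
  proof safe
    fix x assume "x < n div K"
    then have "Suc x * K \<le> n div K * K" by (intro mult_right_mono) auto
    then show "x * K + k < n" using assms mult_div_le by (simp only: mult_Suc)
  qed
  show "n div K \<le> card {i. i < n \<and> i mod K = k}"
    using card_mono[OF finite_subset[OF sub] sup] by (simp add: card)
  show "card {i. i < n \<and> i mod K = k} \<le> n div K + 1"
    using card_mono[OF _ sub] by (simp add: card)
qed

lemma card_pool_residue:
  assumes "k < 2 * (K div 2)"
  shows "card {i\<in>pool. i mod K = k} = u"
proof -
  have k: "k < K" using assms by linarith
  have "{x. x * K + k < n \<and> x < u} = {..<u}"
  proof safe
    fix x assume "x < u"
    then have "Suc x * K \<le> n div K * K" using u_le by (intro mult_right_mono) auto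
    then show "x * K + k < n" using k mult_div_le by (simp only: mult_Suc)
  qed
  moreover have "{i\<in>pool. i mod K = k} = {i. (i < n \<and> i div K < u) \<and> i mod K = k}"
    using assms by (auto simp: pool_def)
  moreover have "(x * K + k) div K = x" for x using k by simp
  ultimately show ?thesis
    unfolding residue_class_eq[OF k] by (simp add: card_image[OF inj_mult_add])
qed

lemma pool_residue_empty:
  assumes "\<not> k < 2 * (K div 2)"
  shows "{i\<in>pool. i mod K = k} = {}"
  using assms by (auto simp: pool_def)

lemma card_pool_residue_le: "card {i\<in>pool. i mod K = k} \<le> u"
proof (cases "k < 2 * (K div 2)")
  case False
  show ?thesis unfolding pool_residue_empty[OF False] by simp
qed (simp add: card_pool_residue)

lemma card_outside_pool:
  assumes "k < K"
  shows "n div K \<le> card {i. i < n \<and> i \<notin> pool \<and> i mod K = k} + card {i\<in>pool. i mod K = k}"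
    "card {i. i < n \<and> i \<notin> pool \<and> i mod K = k} + card {i\<in>pool. i mod K = k} \<le> n div K + 1"
proof -
  have "{i. i < n \<and> i mod K = k} = {i. i < n \<and> i \<notin> pool \<and> i mod K = k} \<union> {i\<in>pool. i mod K = k}"
    by (auto simp: pool_def)
  then have "card {i. i < n \<and> i mod K = k} =
      card {i. i < n \<and> i \<notin> pool \<and> i mod K = k} + card {i\<in>pool. i mod K = k}"
    by (simp add: card_Un_disjoint disjoint_iff)
  then show "n div K \<le> card {i. i < n \<and> i \<notin> pool \<and> i mod K = k} + card {i\<in>pool. i mod K = k}"
    "card {i. i < n \<and> i \<notin> pool \<and> i mod K = k} + card {i\<in>pool. i mod K = k} \<le> n div K + 1"
    using card_residue_class[OF assms] by auto
qed

text \<open>A prior assignment only redistributes labels inside a pair, whose two residue classes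
  supply \<open>u\<close> pool nodes each. So the count of the first label determines that of the
  second.\<close>

lemma card_pool_pair:
  assumes "\<sigma> \<in> prior" "j < K div 2"
  shows "card {i\<in>pool. \<sigma> i = 2 * j} + card {i\<in>pool. \<sigma> i = 2 * j + 1} = 2 * u"
proof -
  have un: "card {i\<in>pool. f i = 2 * j} + card {i\<in>pool. f i = 2 * j + 1} = card {i\<in>pool. f i div 2 = j}"
    for f :: "nat \<Rightarrow> nat"
  proof -
    have "{i\<in>pool. f i div 2 = j} = {i\<in>pool. f i = 2 * j} \<union> {i\<in>pool. f i = 2 * j + 1}"
      by auto
    then show ?thesis by (simp add: card_Un_disjoint disjoint_iff)
  qed
  have "{i\<in>pool. \<sigma> i div 2 = j} = {i\<in>pool. i mod K div 2 = j}"
    using assms by (auto simp: prior_def)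
  moreover have "card {i\<in>pool. i mod K = 2 * j} + card {i\<in>pool. i mod K = 2 * j + 1} = 2 * u"
    using assms(2) by (simp add: card_pool_residue)
  ultimately show ?thesis by (simp only: un)
qed

lemma card_pool_label:
  assumes "\<sigma> \<in> prior"
  shows "card {i\<in>pool. \<sigma> i = k} \<le> u + 1"
    "card {i\<in>pool. i mod K = k} \<le> card {i\<in>pool. \<sigma> i = k} + 1"
    "card {i\<in>pool. \<sigma> i = k} \<le> card {i\<in>pool. i mod K = k} + 1"
proof -
  have "card {i\<in>pool. \<sigma> i = k} \<le> u + 1 \<and> card {i\<in>pool. i mod K = k} \<le> card {i\<in>pool. \<sigma> i = k} + 1
    \<and> card {i\<in>pool. \<sigma> i = k} \<le> card {i\<in>pool. i mod K = k} + 1"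
  proof (cases "k < 2 * (K div 2)")
    case True
    then have j: "k div 2 < K div 2" by linarith
    have "card {i\<in>pool. \<sigma> i = 2 * (k div 2)} \<in> {u - 1, u}"
      using assms j by (auto simp: prior_def)
    moreover note card_pool_pair[OF assms j] card_pool_residue[OF True]
    moreover have "k = 2 * (k div 2) \<or> k = 2 * (k div 2) + 1" by linarith
    ultimately show ?thesis by auto
  next
    case False
    \<comment> \<open>Pool labels lie in complete pairs, so for odd \<open>K\<close> the last label
      never occurs there.\<close>
    have "{i\<in>pool. \<sigma> i = k} = {}"
    proof safe
      fix i assume "i \<in> pool" "k = \<sigma> i"
      then have "\<sigma> i div 2 = i mod K div 2" "i mod K < 2 * (K div 2)"
        using assms by (auto simp: prior_def pool_def)
      with False \<open>k = \<sigma> i\<close> show "i \<in> {}" using less_double_if_div_eq by blast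
    qed
    then show ?thesis by (simp only: pool_residue_empty[OF False] card.empty) simp
  qed
  then show "card {i\<in>pool. \<sigma> i = k} \<le> u + 1"
    "card {i\<in>pool. i mod K = k} \<le> card {i\<in>pool. \<sigma> i = k} + 1"
    "card {i\<in>pool. \<sigma> i = k} \<le> card {i\<in>pool. i mod K = k} + 1" by auto
qed

text \<open>Outside the pool the labels are \<open>i mod K\<close>. Rounding \<open>n / K\<close>
  accounts for one node of the upper slack, the pool for one node in either direction.\<close>

lemma card_community:
  assumes "\<sigma> \<in> prior" "k < K"
  shows "n div K \<le> card {i\<in>{..<n}. \<sigma> i = k} + 1" "card {i\<in>{..<n}. \<sigma> i = k} \<le> n div K + 2"
proof -
  have "{i\<in>{..<n}. \<sigma> i = k} = {i. i < n \<and> i \<notin> pool \<and> i mod K = k} \<union> {i\<in>pool. \<sigma> i = k}"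
    using assms(1) by (auto simp: prior_def pool_def)
  then have "card {i\<in>{..<n}. \<sigma> i = k} =
      card {i. i < n \<and> i \<notin> pool \<and> i mod K = k} + card {i\<in>pool. \<sigma> i = k}"
    by (simp add: card_Un_disjoint disjoint_iff)
  then show "n div K \<le> card {i\<in>{..<n}. \<sigma> i = k} + 1" "card {i\<in>{..<n}. \<sigma> i = k} \<le> n div K + 2"
    using card_outside_pool[OF assms(2)] card_pool_label(2,3)[OF assms(1), of k] by linarith+
qed

lemma prior_subset_Theta0:
  assumes "2 * real K / real n \<le> eta"
  shows "prior \<subseteq> Theta0 n K eta"
proof
  fix \<sigma> assume \<sigma>: "\<sigma> \<in> prior"
  have n: "0 < n" using u_le by (cases n) auto
  have K: "0 < K" using K_ge by simp
  have "real n = real (n div K) * real K + real (n mod K)"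
    by (metis div_mult_mod_eq of_nat_add of_nat_mult)
  moreover have "real (n mod K) < real K" using K by simp
  ultimately have q: "real (n div K) \<le> real n / real K" "real n / real K \<le> real (n div K) + 1"
    using K by (auto simp: field_simps)
  define X where "X = real n / real K"
  define Q where "Q = real (n div K)"
  \<comment> \<open>The lower bound on \<open>eta\<close> amounts to a tolerance of two nodes per
    community, which covers both the rounding and the pool.\<close>
  have "2 * real K / real n * (real n / real K) \<le> eta * (real n / real K)"
    using assms by (intro mult_right_mono) auto
  then have e: "2 \<le> eta * (real n / real K)" using n K by simp
  show "\<sigma> \<in> Theta0 n K eta"
    unfolding Theta0_def
  proof (intro CollectI conjI allI impI)
    show "\<sigma> \<in> assignments n K" using \<sigma> by (simp add: prior_def)
    fix k assume k: "k < K"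
    have c: "real (n div K) \<le> real (card {i\<in>{..<n}. \<sigma> i = k}) + 1"
      "real (card {i\<in>{..<n}. \<sigma> i = k}) \<le> real (n div K) + 2"
      using card_community[OF \<sigma> k] by linarith+
    have "(1 - eta) * real n / real K = real n / real K - eta * (real n / real K)"
      "(1 + eta) * real n / real K = real n / real K + eta * (real n / real K)"
      by (simp_all add: ring_distribs add_divide_distrib diff_divide_distrib)
    then show "(1 - eta) * real n / real K \<le> real (card {i\<in>{..<n}. \<sigma> i = k})"
      "real (card {i\<in>{..<n}. \<sigma> i = k}) \<le> (1 + eta) * real n / real K"
      using q e c unfolding X_def[symmetric] Q_def[symmetric] by linarith+
  qed
qed

section \<open>Flips that stay in the prior\<close>

lemma flip_in_priorI:
  assumes \<sigma>: "\<sigma> \<in> prior" and i: "i \<in> pool"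
    and ok: "even (\<sigma> i) \<longleftrightarrow> card {l\<in>pool. \<sigma> l = 2 * (\<sigma> i div 2)} = u"
  shows "flip i \<sigma> \<in> prior"
proof -
  have lt: "\<sigma> i < 2 * (K div 2)"
  proof -
    have "\<sigma> i div 2 = i mod K div 2" "i mod K < 2 * (K div 2)"
      using \<sigma> i by (auto simp: prior_def pool_def)
    then show ?thesis by (rule less_double_if_div_eq)
  qed
  then have lt': "partner (\<sigma> i) < 2 * (K div 2)"
    by (rule less_double_if_div_eq[OF partner_div])
  have "i < n" using i by (simp add: pool_def)
  have cnt: "card {l\<in>pool. flip i \<sigma> l = 2 * j} \<in> {u - 1, u}" if j: "j < K div 2" for j
  proof (cases "j = \<sigma> i div 2")
    case False
    have "partner (\<sigma> i) \<noteq> 2 * j"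
    proof
      assume "partner (\<sigma> i) = 2 * j"
      then have "2 * j div 2 = \<sigma> i div 2"
        using partner_div[of "\<sigma> i"] by (simp only:)
      with False show False by simp
    qed
    moreover have "\<sigma> i \<noteq> 2 * j" using False by auto
    ultimately have "{l\<in>pool. flip i \<sigma> l = 2 * j} = {l\<in>pool. \<sigma> l = 2 * j}"
      by (auto simp: flip_def)
    then show ?thesis using \<sigma> j by (auto simp: prior_def)
  next
    case True
    have old: "card {l\<in>pool. \<sigma> l = 2 * j} \<in> {u - 1, u}"
      using \<sigma> j by (auto simp: prior_def)
    have ok': "even (\<sigma> i) \<longleftrightarrow> card {l\<in>pool. \<sigma> l = 2 * j} = u"
      unfolding True by (rule ok)
    have fin: "finite {l\<in>pool. \<sigma> l = 2 * j}" by simp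
    \<comment> \<open>Giving up the even label lowers its count, which must have been
      \<open>u\<close>; taking it on raises the count, which must have been
      \<open>u - 1\<close>.\<close>
    show ?thesis
    proof (cases "even (\<sigma> i)")
      case ev: True
      then have \<sigma>i: "\<sigma> i = 2 * j" unfolding True by simp
      have "{l\<in>pool. flip i \<sigma> l = 2 * j} = {l\<in>pool. \<sigma> l = 2 * j} - {i}"
        by (auto simp: flip_def partner_def \<sigma>i)
      moreover have "card ({l\<in>pool. \<sigma> l = 2 * j} - {i}) = u - 1"
        using card_Diff_singleton[of i "{l\<in>pool. \<sigma> l = 2 * j}"] ok' ev i \<sigma>i by auto
      ultimately show ?thesis by simp
    next
      case od: False
      then have \<sigma>i: "\<sigma> i = 2 * j + 1" unfolding True by (metis odd_two_times_div_two_succ)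
      have "{l\<in>pool. flip i \<sigma> l = 2 * j} = insert i {l\<in>pool. \<sigma> l = 2 * j}"
        using i by (auto simp: flip_def partner_def \<sigma>i)
      moreover have "card (insert i {l\<in>pool. \<sigma> l = 2 * j}) = Suc (card {l\<in>pool. \<sigma> l = 2 * j})"
        using \<sigma>i by (intro card_insert_disjoint[OF fin]) auto
      moreover have "card {l\<in>pool. \<sigma> l = 2 * j} = u - 1" using old ok' od by blast
      ultimately show ?thesis using u_ge by simp
    qed
  qed
  have "flip i \<sigma> \<in> assignments n K"
    using \<sigma> lt' \<open>i < n\<close> by (auto simp: prior_def flip_def assignments_def PiE_iff extensional_def)
  moreover have "flip i \<sigma> l = l mod K" if "l < n" "l \<notin> pool" for l
    using that i \<sigma> by (auto simp: flip_def prior_def)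
  moreover have "flip i \<sigma> l div 2 = l mod K div 2" if "l \<in> pool" for l
    using that \<sigma> by (auto simp: flip_def prior_def)
  ultimately show ?thesis using cnt by (auto simp: prior_def)
qed

text \<open>In each pair one whole label class can flip: that of the first label if it has
  \<open>u\<close> nodes, otherwise that of the second, which then has \<open>u + 1\<close>.\<close>

lemma card_flippable:
  assumes \<sigma>: "\<sigma> \<in> prior"
  shows "(K div 2) * u \<le> card {i\<in>pool. flip i \<sigma> \<in> prior}"
proof -
  define G where "G j = {i\<in>pool. \<sigma> i div 2 = j \<and> flip i \<sigma> \<in> prior}" for j
  have G: "u \<le> card (G j)" if j: "j < K div 2" for j
  proof (cases "card {i\<in>pool. \<sigma> i = 2 * j} = u")
    case True
    have "{i\<in>pool. \<sigma> i = 2 * j} \<subseteq> G j"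
      using True by (auto simp: G_def intro!: flip_in_priorI[OF \<sigma>])
    from card_mono[OF _ this] True show ?thesis by (simp add: G_def)
  next
    case False
    have "{i\<in>pool. \<sigma> i = 2 * j + 1} \<subseteq> G j"
      using False by (auto simp: G_def intro!: flip_in_priorI[OF \<sigma>])
    from card_mono[OF _ this] have "card {i\<in>pool. \<sigma> i = 2 * j + 1} \<le> card (G j)"
      by (simp add: G_def)
    moreover have "card {i\<in>pool. \<sigma> i = 2 * j} \<le> u"
      using \<sigma> j by (auto simp: prior_def)
    ultimately show ?thesis using card_pool_pair[OF \<sigma> j] by linarith
  qed
  have "(K div 2) * u = (\<Sum>j<K div 2. u)" by simp
  also have "\<dots> \<le> (\<Sum>j<K div 2. card (G j))" by (intro sum_mono G) auto
  also have "\<dots> = card (\<Union>j<K div 2. G j)"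
    by (intro card_UN_disjoint[symmetric]) (auto simp: G_def)
  also have "\<dots> \<le> card {i\<in>pool. flip i \<sigma> \<in> prior}"
    by (intro card_mono) (auto simp: G_def)
  finally show ?thesis .
qed

lemma prior_nonempty: "prior \<noteq> {}"
proof -
  have K: "0 < K" using K_ge by simp
  have "(\<lambda>i\<in>{..<n}. i mod K) \<in> prior"
  proof -
    have "{i\<in>pool. (\<lambda>i\<in>{..<n}. i mod K) i = 2 * j} = {i\<in>pool. i mod K = 2 * j}" for j
      by (auto simp: pool_def)
    then show ?thesis
      using K by (auto simp: prior_def assignments_def card_pool_residue) (auto simp: pool_def)
  qed
  then show ?thesis by auto
qed

text \<open>A relabelling that moves a label pays on the known nodes of that community, which outnumber
  the pool nodes it could correct.\<close>

lemma card_diff_le_permuted: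
  assumes \<sigma>: "\<sigma> \<in> prior" and \<tau>: "\<tau> \<in> prior" and \<delta>: "\<delta> permutes {..<K}"
  shows "card {i\<in>{..<n}. \<sigma> i \<noteq> \<tau> i} \<le> card {i\<in>{..<n}. \<sigma> i \<noteq> \<delta> (\<tau> i)}"
proof -
  define L where "L = {k. k < K \<and> \<delta> k \<noteq> k}"
  have L: "finite L" by (simp add: L_def)
  have K: "0 < K" using K_ge by simp
  have out: "\<sigma> i = i mod K" "\<tau> i = i mod K" if "i < n" "i \<notin> pool" for i
    using \<sigma> \<tau> that by (auto simp: prior_def)
  have pool_lt: "i < n" if "i \<in> pool" for i using that by (simp add: pool_def)
  have \<tau>_lt: "\<tau> i < K" if "i < n" for i
    using \<tau> that by (auto simp: prior_def assignments_def)
  \<comment> \<open>A disagreement lies in the pool, and there either \<open>\<delta>\<close> moves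
    the label \<open>\<tau> i\<close> or the disagreement survives the relabelling.\<close>
  have "{i\<in>{..<n}. \<sigma> i \<noteq> \<tau> i} \<subseteq> (\<Union>k\<in>L. {i\<in>pool. \<tau> i = k}) \<union> {i\<in>pool. \<sigma> i \<noteq> \<delta> (\<tau> i)}"
  proof
    fix i assume "i \<in> {i\<in>{..<n}. \<sigma> i \<noteq> \<tau> i}"
    then have i: "i < n" "\<sigma> i \<noteq> \<tau> i" by auto
    then have "i \<in> pool" using out[of i] by metis
    then show "i \<in> (\<Union>k\<in>L. {i\<in>pool. \<tau> i = k}) \<union> {i\<in>pool. \<sigma> i \<noteq> \<delta> (\<tau> i)}"
      using i \<tau>_lt[of i] by (cases "\<delta> (\<tau> i) = \<tau> i") (auto simp: L_def)
  qed
  then have "card {i\<in>{..<n}. \<sigma> i \<noteq> \<tau> i}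
      \<le> card ((\<Union>k\<in>L. {i\<in>pool. \<tau> i = k}) \<union> {i\<in>pool. \<sigma> i \<noteq> \<delta> (\<tau> i)})"
    using L by (intro card_mono) auto
  also have "\<dots> \<le> card (\<Union>k\<in>L. {i\<in>pool. \<tau> i = k}) + card {i\<in>pool. \<sigma> i \<noteq> \<delta> (\<tau> i)}"
    by (rule card_Un_le)
  also have "card (\<Union>k\<in>L. {i\<in>pool. \<tau> i = k}) \<le> card {i. i < n \<and> i \<notin> pool \<and> \<sigma> i \<noteq> \<delta> (\<tau> i)}"
  proof -
    have "card (\<Union>k\<in>L. {i\<in>pool. \<tau> i = k}) \<le> (\<Sum>k\<in>L. card {i\<in>pool. \<tau> i = k})"
      by (rule card_UN_le[OF L])
    also have "\<dots> \<le> (\<Sum>k\<in>L. card {i. i < n \<and> i \<notin> pool \<and> i mod K = k})"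
    proof (rule sum_mono)
      fix k assume "k \<in> L"
      then have k: "k < K" by (simp add: L_def)
      have "card {i\<in>pool. i mod K = k} \<le> u"
        by (rule card_pool_residue_le)
      then show "card {i\<in>pool. \<tau> i = k} \<le> card {i. i < n \<and> i \<notin> pool \<and> i mod K = k}"
        using card_pool_label(1)[OF \<tau>, of k] card_outside_pool(1)[OF k] u_le by linarith
    qed
    also have "\<dots> = card (\<Union>k\<in>L. {i. i < n \<and> i \<notin> pool \<and> i mod K = k})"
      using L by (intro card_UN_disjoint[symmetric]) auto
    also have "\<dots> \<le> card {i. i < n \<and> i \<notin> pool \<and> \<sigma> i \<noteq> \<delta> (\<tau> i)}"
      by (intro card_mono) (auto simp: L_def out)
    finally show ?thesis .
  qed
  also have "card {i. i < n \<and> i \<notin> pool \<and> \<sigma> i \<noteq> \<delta> (\<tau> i)} + card {i\<in>pool. \<sigma> i \<noteq> \<delta> (\<tau> i)}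
      = card ({i. i < n \<and> i \<notin> pool \<and> \<sigma> i \<noteq> \<delta> (\<tau> i)} \<union> {i\<in>pool. \<sigma> i \<noteq> \<delta> (\<tau> i)})"
    by (rule card_Un_disjoint[symmetric]) auto
  also have "{i. i < n \<and> i \<notin> pool \<and> \<sigma> i \<noteq> \<delta> (\<tau> i)} \<union> {i\<in>pool. \<sigma> i \<noteq> \<delta> (\<tau> i)}
      = {i\<in>{..<n}. \<sigma> i \<noteq> \<delta> (\<tau> i)}"
    using pool_lt by auto
  finally show ?thesis by simp
qed

section \<open>Projection of an estimate to the prior\<close>

definition proj :: "(nat \<Rightarrow> nat) \<Rightarrow> nat \<Rightarrow> nat" where
  "proj \<tau> = arg_min_on (\<lambda>\<sigma>. mismatch n K \<sigma> \<tau>) prior"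

lemma proj_in_prior: "proj \<tau> \<in> prior"
  unfolding proj_def by (rule arg_min_if_finite(1)) (auto simp: prior_nonempty)

lemma mismatch_attained:
  obtains \<delta> where "\<delta> permutes {..<K}"
    "mismatch n K \<sigma> \<tau> = real (card {i\<in>{..<n}. \<sigma> i \<noteq> \<delta> (\<tau> i)}) / real n"
proof -
  let ?M = "{real (card {i\<in>{..<n}. \<sigma> i \<noteq> \<delta> (\<tau> i)}) / real n | \<delta>. \<delta> permutes {..<K}}"
  have eq: "?M = (\<lambda>\<delta>. real (card {i\<in>{..<n}. \<sigma> i \<noteq> \<delta> (\<tau> i)}) / real n) ` {\<delta>. \<delta> permutes {..<K}}"
    by auto
  have "finite ?M" unfolding eq by (intro finite_imageI finite_permutations) simp
  moreover have "?M \<noteq> {}" using permutes_id by blast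
  ultimately have "Min ?M \<in> ?M" by (rule Min_in)
  then show ?thesis using that by (auto simp: mismatch_def)
qed

lemma card_diff_proj_le:
  assumes \<sigma>: "\<sigma> \<in> prior"
  shows "real (card {i\<in>{..<n}. \<sigma> i \<noteq> proj \<tau> i}) \<le> 2 * real n * mismatch n K \<sigma> \<tau>"
proof -
  have n: "0 < n" using u_le by (cases n) auto
  let ?d = "\<lambda>f g. card {i\<in>{..<n}. f i \<noteq> (g i :: nat)}"
  obtain \<delta> where \<delta>: "\<delta> permutes {..<K}" and d: "mismatch n K \<sigma> \<tau> = real (?d \<sigma> (\<lambda>i. \<delta> (\<tau> i))) / real n"
    by (rule mismatch_attained)
  obtain \<epsilon> where \<epsilon>: "\<epsilon> permutes {..<K}"
    and e: "mismatch n K (proj \<tau>) \<tau> = real (?d (proj \<tau>) (\<lambda>i. \<epsilon> (\<tau> i))) / real n"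
    by (rule mismatch_attained)
  have "mismatch n K (proj \<tau>) \<tau> \<le> mismatch n K \<sigma> \<tau>"
    unfolding proj_def by (rule arg_min_least[OF finite_prior prior_nonempty \<sigma>])
  then have le: "?d (proj \<tau>) (\<lambda>i. \<epsilon> (\<tau> i)) \<le> ?d \<sigma> (\<lambda>i. \<delta> (\<tau> i))"
    using n by (simp add: d e divide_le_cancel)
  have inv: "inv \<epsilon> (\<epsilon> k) = k" for k using \<epsilon> by (simp add: permutes_inverses)
  have perm: "(\<delta> \<circ> inv \<epsilon>) permutes {..<K}"
    using \<delta> \<epsilon> by (simp add: permutes_compose permutes_inv)
  have "?d \<sigma> (proj \<tau>) \<le> ?d \<sigma> (\<lambda>i. (\<delta> \<circ> inv \<epsilon>) (proj \<tau> i))"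
    by (rule card_diff_le_permuted[OF \<sigma> proj_in_prior perm])
  also have "\<dots> \<le> card ({i\<in>{..<n}. \<sigma> i \<noteq> \<delta> (\<tau> i)} \<union> {i\<in>{..<n}. proj \<tau> i \<noteq> \<epsilon> (\<tau> i)})"
    using inv by (intro card_mono) auto
  also have "\<dots> \<le> ?d \<sigma> (\<lambda>i. \<delta> (\<tau> i)) + ?d (proj \<tau>) (\<lambda>i. \<epsilon> (\<tau> i))"
    by (rule card_Un_le)
  also have "\<dots> \<le> 2 * ?d \<sigma> (\<lambda>i. \<delta> (\<tau> i))" using le by simp
  finally have "real (?d \<sigma> (proj \<tau>)) \<le> 2 * real (?d \<sigma> (\<lambda>i. \<delta> (\<tau> i)))"
    by linarith
  then show ?thesis using n by (simp add: d)
qed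

end


subsection \<open>From testing to the minimax risk\<close>

lemma graph_prob_eq_bern_prod: "graph_prob n a b \<sigma> E = bern_prod (edge_prob n a b \<sigma>) (pairs n) E"
  by (simp add: graph_prob_def bern_prod_def)

lemma finite_pairs [simp]: "finite (pairs n)"
  by (rule finite_subset[of _ "{..<n} \<times> {..<n}"]) (auto simp: pairs_def)

lemma graph_prob_nonneg:
  assumes "0 < a / real n" "a / real n < 1" "0 < b / real n" "b / real n < 1"
  shows "0 \<le> graph_prob n a b \<sigma> E"
  unfolding graph_prob_def using assms by (intro prod_nonneg) (auto simp: edge_prob_def)

context sbm_prior
begin

text \<open>Only the edges from \<open>i\<close> to its old community and to the partner community
  change law. The two groups change in opposite directions and, by \<open>card_community\<close>,
  have nearly equal sizes, so the imbalance is bounded.\<close>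

lemma sum_min_flip_ge:
  assumes \<sigma>: "\<sigma> \<in> prior" and i: "i \<in> pool"
    and pq: "0 < a / real n" "a / real n < 1" "0 < b / real n" "b / real n < 1"
    and B: "B = affinity (a / real n) (b / real n)" "B \<le> 1"
    and W: "8 * (1 - B) / B \<le> W"
  shows "B ^ (2 * (n div K) + 3) * exp (- sqrt ((2 * real (n div K) + 19) * W) / 2)
    \<le> (\<Sum>E\<in>Pow (pairs n). min (graph_prob n a b \<sigma> E) (graph_prob n a b (flip i \<sigma>) E))"
proof -
  \<comment> \<open>For \<open>j \<noteq> i\<close>, the edge between \<open>i\<close> and
    \<open>j\<close> with its end points in increasing order, as in \<open>pairs\<close>.\<close>
  define e where "e = (\<lambda>j. (min i j, max i j))"
  define N1 where "N1 = {j\<in>{..<n}. \<sigma> j = \<sigma> i} - {i}"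
  define N2 where "N2 = {j\<in>{..<n}. \<sigma> j = partner (\<sigma> i)}"
  have i_lt: "i < n" using i by (simp add: pool_def)
  have inj: "inj_on e A" for A
    by (auto simp: e_def inj_on_def min_def max_def split: if_splits)
  have i_N2: "i \<notin> N2" using partner_neq[of "\<sigma> i", symmetric] by (simp add: N2_def)
  have lt: "\<sigma> i < K" "partner (\<sigma> i) < K"
  proof -
    have *: "\<sigma> i div 2 = i mod K div 2" "i mod K < 2 * (K div 2)"
      using \<sigma> i by (auto simp: prior_def pool_def)
    have "\<sigma> i < 2 * (K div 2)" by (rule less_double_if_div_eq[OF *])
    moreover from this have "partner (\<sigma> i) < 2 * (K div 2)"
      by (rule less_double_if_div_eq[OF partner_div])
    ultimately show "\<sigma> i < K" "partner (\<sigma> i) < K" by linarith+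
  qed
  have c1: "card N1 + 1 = card {j\<in>{..<n}. \<sigma> j = \<sigma> i}"
    unfolding N1_def using i_lt
      card_Suc_Diff1[of "{j\<in>{..<n}. \<sigma> j = \<sigma> i}" i] by simp
  define D1 where "D1 = e ` N1"
  define D2 where "D2 = e ` N2"
  have card_D: "card D1 = card N1" "card D2 = card N2"
    unfolding D1_def D2_def by (rule card_image[OF inj])+
  have bounds: "card D1 \<le> n div K + 1" "n div K \<le> card D1 + 2" "card D2 \<le> n div K + 2" "n div K \<le> card D2 + 1"
    using c1 card_community[OF \<sigma> lt(1)] card_community[OF \<sigma> lt(2)]
    unfolding card_D N2_def by linarith+
  have e_pairs: "e j \<in> pairs n" if "j < n" "j \<noteq> i" for j
    using that i_lt by (auto simp: e_def pairs_def)
  have sub: "D1 \<subseteq> pairs n" "D2 \<subseteq> pairs n"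
  proof -
    have N: "j < n \<and> j \<noteq> i" if "j \<in> N1 \<union> N2" for j
      using that i_N2 by (cases "j = i") (simp_all add: N1_def N2_def, blast)
    then show "D1 \<subseteq> pairs n" "D2 \<subseteq> pairs n"
      unfolding D1_def D2_def by (intro image_subsetI e_pairs; use N in blast)+
  qed
  have "j \<notin> N2" if "j \<in> N1" for j
    using that partner_neq[of "\<sigma> i", symmetric] by (simp add: N1_def N2_def)
  then have "N1 \<inter> N2 = {}" by blast
  then have disj: "D1 \<inter> D2 = {}"
    unfolding D1_def D2_def by (simp add: image_Int[OF inj, symmetric])
  let ?p = "a / real n" and ?q = "b / real n"
  let ?f = "edge_prob n a b \<sigma>" and ?g = "edge_prob n a b (flip i \<sigma>)"
  have f1: "?f (e j) = (if \<sigma> j = \<sigma> i then ?p else ?q)" for j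
    by (auto simp: edge_prob_def e_def min_def max_def)
  have g1: "?g (e j) = (if \<sigma> j = partner (\<sigma> i) then ?p else ?q)" if "j \<noteq> i" for j
    using that by (auto simp: edge_prob_def e_def min_def max_def flip_def)
  have rest: "?f x = ?g x \<and> 0 < ?f x \<and> ?f x < 1" if "x \<in> pairs n - D1 - D2" for x
  proof -
    have "?f x = ?g x"
    proof (cases "fst x = i \<or> snd x = i")
      case True
      define j where "j = (if fst x = i then snd x else fst x)"
      have "fst x < snd x" "snd x < n" using that by (auto simp: pairs_def)
      with True have j: "x = e j" "j \<noteq> i" "j < n"
        by (auto simp: j_def e_def prod_eq_iff)
      \<comment> \<open>An edge to a third community has probability \<open>?q\<close> before and
        after the flip.\<close>
      then have "j \<notin> N1" "j \<notin> N2" using that by (auto simp: D1_def D2_def)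
      then have "\<sigma> j \<noteq> \<sigma> i" "\<sigma> j \<noteq> partner (\<sigma> i)" using j by (auto simp: N1_def N2_def)
      then show ?thesis using f1[of j] g1[of j] j by simp
    next
      case False
      then show ?thesis by (simp add: edge_prob_def flip_def)
    qed
    then show ?thesis using pq by (auto simp: edge_prob_def)
  qed
  have "affinity ?p ?q ^ (card D1 + card D2) * exp (- sqrt ((real (card D1 + card D2) + 4\<^sup>2) * W) / 2)
      \<le> (\<Sum>E\<in>Pow (pairs n). min (bern_prod ?f (pairs n) E) (bern_prod ?g (pairs n) E))"
  proof (rule sum_min_two_valued_ge[OF finite_pairs sub disj pq _ _ rest])
    show "?f x = ?p \<and> ?g x = ?q" if "x \<in> D1" for x
    proof -
      obtain j where "x = e j" "j \<in> N1" using \<open>x \<in> D1\<close> unfolding D1_def by blast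
      moreover from this have "j \<noteq> i" "\<sigma> j = \<sigma> i" by (simp_all add: N1_def)
      ultimately show ?thesis
        using f1[of j] g1[of j] partner_neq[of "\<sigma> i", symmetric] by simp
    qed
    show "?f x = ?q \<and> ?g x = ?p" if "x \<in> D2" for x
    proof -
      obtain j where "x = e j" "j \<in> N2" using \<open>x \<in> D2\<close> unfolding D2_def by blast
      moreover from this have "j \<noteq> i" using i_N2 by blast
      moreover have "\<sigma> j = partner (\<sigma> i)" using \<open>j \<in> N2\<close> by (simp add: N2_def)
      moreover from this have "\<sigma> j \<noteq> \<sigma> i" by simp
      ultimately show ?thesis using f1[of j] g1[of j] by simp
    qed
    show "\<bar>real (card D1) - real (card D2)\<bar> \<le> 4" using bounds by linarith
    show "8 * (1 - affinity ?p ?q) / affinity ?p ?q \<le> W" using W B by simp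
  qed
  \<comment> \<open>The size bounds give at most \<open>2 * (n div K) + 3\<close> affected edges; 19
    is 3 plus the square of the imbalance bound 4.\<close>
  moreover have "B ^ (2 * (n div K) + 3) * exp (- sqrt ((2 * real (n div K) + 19) * W) / 2)
    \<le> B ^ (card D1 + card D2) * exp (- sqrt ((real (card D1 + card D2) + 4\<^sup>2) * W) / 2)"
  proof (rule mult_mono)
    have B0: "0 < B" using affinity_pos pq B by simp
    then show "B ^ (2 * (n div K) + 3) \<le> B ^ (card D1 + card D2)"
      using B bounds by (intro power_decreasing) auto
    have "0 \<le> 8 * (1 - B) / B" using B B0 by simp
    then have "0 \<le> W" using W by linarith
    moreover have "real (card D1 + card D2) + 4\<^sup>2 \<le> 2 * real (n div K) + 19" using bounds by simp
    ultimately show "exp (- sqrt ((2 * real (n div K) + 19) * W) / 2)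
        \<le> exp (- sqrt ((real (card D1 + card D2) + 4\<^sup>2) * W) / 2)"
      by (simp add: mult_right_mono del: of_nat_add)
    show "0 \<le> B ^ (card D1 + card D2)" using B0 by simp
  qed simp
  ultimately show ?thesis by (simp add: graph_prob_eq_bern_prod B(1))
qed

text \<open>Linearity of expectation turns the number of wrong pool nodes of the projection into
  node-wise error probabilities. The 2 is the price of projecting.\<close>

lemma expectation_mismatch_ge:
  assumes "est \<in> estimators n K" and \<sigma>: "\<sigma> \<in> prior"
  shows "(\<Sum>i\<in>pool. measure_pmf.prob (est E) {\<tau>. proj \<tau> i \<noteq> \<sigma> i}) / (2 * real n)
    \<le> measure_pmf.expectation (est E) (\<lambda>\<tau>. mismatch n K \<sigma> \<tau>)"
proof -
  have n: "0 < n" using u_le by (cases n) auto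
  have fin: "finite (set_pmf (est E))"
    using assms(1) finite_assignments by (auto simp: estimators_def intro: finite_subset)
  have "(\<Sum>i\<in>pool. measure_pmf.prob (est E) {\<tau>. proj \<tau> i \<noteq> \<sigma> i}) / (2 * real n)
      = measure_pmf.expectation (est E) (\<lambda>\<tau>. (\<Sum>i\<in>pool. indicator {\<tau>. proj \<tau> i \<noteq> \<sigma> i} \<tau>) / (2 * real n))"
    by (simp add: integrable_measure_pmf_finite[OF fin])
  also have "\<dots> \<le> measure_pmf.expectation (est E) (\<lambda>\<tau>. mismatch n K \<sigma> \<tau>)"
  proof (rule integral_mono)
    fix \<tau>
    have "(\<Sum>i\<in>pool. indicator {\<tau>. proj \<tau> i \<noteq> \<sigma> i} \<tau>) = real (card {i\<in>pool. \<sigma> i \<noteq> proj \<tau> i})"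
      by (simp add: indicator_def sum.If_cases Int_def eq_commute)
    also have "card {i\<in>pool. \<sigma> i \<noteq> proj \<tau> i} \<le> card {i\<in>{..<n}. \<sigma> i \<noteq> proj \<tau> i}"
      by (intro card_mono) (auto simp: pool_def)
    also have "real (card {i\<in>{..<n}. \<sigma> i \<noteq> proj \<tau> i}) \<le> 2 * real n * mismatch n K \<sigma> \<tau>"
      by (rule card_diff_proj_le[OF \<sigma>])
    finally show "(\<Sum>i\<in>pool. indicator {\<tau>. proj \<tau> i \<noteq> \<sigma> i} \<tau>) / (2 * real n) \<le> mismatch n K \<sigma> \<tau>"
      using n by (simp add: field_simps)
  qed (auto intro: integrable_measure_pmf_finite[OF fin])
  finally show ?thesis .
qed

text \<open>Le Cam's two-point argument for a fixed graph: one guess cannot be right for both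
  labels, so the two error probabilities sum to at least 1 and the smaller weight is lost. The
  halving is due to each assignment occurring both as itself and as a flip.\<close>

lemma sum_flippable_ge:
  assumes nonneg: "\<And>\<sigma> E. 0 \<le> w \<sigma> E"
  defines "S \<equiv> \<lambda>i. {\<sigma>\<in>prior. flip i \<sigma> \<in> prior}"
  shows "(\<Sum>\<sigma>\<in>S i. min (w \<sigma> E) (w (flip i \<sigma>) E)) / 2
    \<le> (\<Sum>\<sigma>\<in>prior. w \<sigma> E * measure_pmf.prob (D::(nat \<Rightarrow> nat) pmf) {\<tau>. proj \<tau> i \<noteq> \<sigma> i})"
proof -
  let ?\<psi> = "\<lambda>k. measure_pmf.prob D {\<tau>. proj \<tau> i \<noteq> k}"
  have \<psi>: "1 \<le> ?\<psi> k + ?\<psi> l" if "k \<noteq> l" for k l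
  proof -
    have "{\<tau>. proj \<tau> i \<noteq> k} \<union> {\<tau>. proj \<tau> i \<noteq> l} = UNIV" using that by auto
    then have "1 = measure_pmf.prob D ({\<tau>. proj \<tau> i \<noteq> k} \<union> {\<tau>. proj \<tau> i \<noteq> l})"
      using measure_pmf.prob_space[of D] by simp
    also have "\<dots> \<le> ?\<psi> k + ?\<psi> l" by (intro measure_Un_le) auto
    finally show ?thesis .
  qed
  have "(\<Sum>\<sigma>\<in>S i. min (w \<sigma> E) (w (flip i \<sigma>) E))
      \<le> (\<Sum>\<sigma>\<in>S i. w \<sigma> E * ?\<psi> (\<sigma> i) + w (flip i \<sigma>) E * ?\<psi> (flip i \<sigma> i))"
  proof (rule sum_mono)
    fix \<sigma>
    let ?m = "min (w \<sigma> E) (w (flip i \<sigma>) E)"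
    have "flip i \<sigma> i \<noteq> \<sigma> i" by (simp add: flip_def)
    then have "?m * 1 \<le> ?m * (?\<psi> (\<sigma> i) + ?\<psi> (flip i \<sigma> i))"
      using nonneg by (intro mult_left_mono \<psi>) auto
    also have "\<dots> = ?m * ?\<psi> (\<sigma> i) + ?m * ?\<psi> (flip i \<sigma> i)"
      by (rule distrib_left)
    also have "\<dots> \<le> w \<sigma> E * ?\<psi> (\<sigma> i) + w (flip i \<sigma>) E * ?\<psi> (flip i \<sigma> i)"
      by (intro add_mono mult_right_mono) auto
    finally show "?m \<le> w \<sigma> E * ?\<psi> (\<sigma> i) + w (flip i \<sigma>) E * ?\<psi> (flip i \<sigma> i)" by simp
  qed
  also have "\<dots> = (\<Sum>\<sigma>\<in>S i. w \<sigma> E * ?\<psi> (\<sigma> i)) + (\<Sum>\<sigma>\<in>S i. w (flip i \<sigma>) E * ?\<psi> (flip i \<sigma> i))"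
    by (rule sum.distrib)
  also have "(\<Sum>\<sigma>\<in>S i. w (flip i \<sigma>) E * ?\<psi> (flip i \<sigma> i)) = (\<Sum>\<sigma>\<in>S i. w \<sigma> E * ?\<psi> (\<sigma> i))"
    by (rule sum.reindex_bij_witness[of _ "flip i" "flip i"]) (auto simp: S_def)
  also have "(\<Sum>\<sigma>\<in>S i. w \<sigma> E * ?\<psi> (\<sigma> i)) \<le> (\<Sum>\<sigma>\<in>prior. w \<sigma> E * ?\<psi> (\<sigma> i))"
    using nonneg by (intro sum_mono2) (auto simp: S_def)
  finally show ?thesis by simp
qed

text \<open>A bound on the Bayes risk under the uniform law on \<open>prior\<close>. Of the factor
  4, one 2 comes from the two-point bound and the other from the projection.\<close>

lemma sum_risk_ge:
  assumes est: "est \<in> estimators n K"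
    and nonneg: "\<And>\<sigma> E. 0 \<le> graph_prob n a b \<sigma> E" and "0 \<le> \<beta>"
    and \<beta>: "\<And>\<sigma> i. \<sigma> \<in> prior \<Longrightarrow> i \<in> pool \<Longrightarrow>
      \<beta> \<le> (\<Sum>E\<in>Pow (pairs n). min (graph_prob n a b \<sigma> E) (graph_prob n a b (flip i \<sigma>) E))"
  shows "real (card prior) * (real (K div 2 * u) * \<beta> / (4 * real n)) \<le> (\<Sum>\<sigma>\<in>prior. risk n K a b est \<sigma>)"
proof -
  let ?P = "graph_prob n a b"
  let ?\<psi> = "\<lambda>E i \<sigma>. measure_pmf.prob (est E) {\<tau>. proj \<tau> i \<noteq> \<sigma> i}"
  let ?S = "\<lambda>i. {\<sigma>\<in>prior. flip i \<sigma> \<in> prior}"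
  have "real (card prior) * (real (K div 2 * u) * \<beta>) = (\<Sum>\<sigma>\<in>prior. real (K div 2 * u)) * \<beta>"
    by simp
  also have "\<dots> \<le> (\<Sum>\<sigma>\<in>prior. real (card {i\<in>pool. flip i \<sigma> \<in> prior})) * \<beta>"
    using card_flippable \<open>0 \<le> \<beta>\<close> by (intro mult_right_mono sum_mono) (auto simp del: of_nat_mult)
  also have "\<dots> = (\<Sum>\<sigma>\<in>prior. \<Sum>i\<in>{i\<in>pool. flip i \<sigma> \<in> prior}. \<beta>)"
    by (simp add: sum_distrib_right)
  \<comment> \<open>Double counting of assignments together with a node that they can flip: the
    count per assignment becomes a count per node, where the test takes place.\<close>
  also have "\<dots> = (\<Sum>i\<in>pool. \<Sum>\<sigma>\<in>?S i. \<beta>)"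
    by (rule sum.swap_restrict) auto
  also have "\<dots> \<le> (\<Sum>i\<in>pool. \<Sum>\<sigma>\<in>?S i. \<Sum>E\<in>Pow (pairs n). min (?P \<sigma> E) (?P (flip i \<sigma>) E))"
    by (intro sum_mono \<beta>) auto
  also have "\<dots> = (\<Sum>i\<in>pool. \<Sum>E\<in>Pow (pairs n). \<Sum>\<sigma>\<in>?S i. min (?P \<sigma> E) (?P (flip i \<sigma>) E))"
    by (intro sum.cong refl sum.swap)
  also have "\<dots> \<le> (\<Sum>i\<in>pool. \<Sum>E\<in>Pow (pairs n). 2 * (\<Sum>\<sigma>\<in>prior. ?P \<sigma> E * ?\<psi> E i \<sigma>))"
  proof (intro sum_mono)
    fix i E
    show "(\<Sum>\<sigma>\<in>?S i. min (?P \<sigma> E) (?P (flip i \<sigma>) E)) \<le> 2 * (\<Sum>\<sigma>\<in>prior. ?P \<sigma> E * ?\<psi> E i \<sigma>)"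
      using sum_flippable_ge[where w = ?P and E = E and i = i and D = "est E", OF nonneg] by linarith
  qed
  also have "\<dots> = (\<Sum>E\<in>Pow (pairs n). \<Sum>i\<in>pool. 2 * (\<Sum>\<sigma>\<in>prior. ?P \<sigma> E * ?\<psi> E i \<sigma>))"
    by (rule sum.swap)
  also have "\<dots> = (\<Sum>E\<in>Pow (pairs n). 2 * (\<Sum>\<sigma>\<in>prior. ?P \<sigma> E * (\<Sum>i\<in>pool. ?\<psi> E i \<sigma>)))"
    unfolding sum_distrib_left by (intro sum.cong refl sum.swap)
  also have "\<dots> = 2 * (\<Sum>\<sigma>\<in>prior. \<Sum>E\<in>Pow (pairs n). ?P \<sigma> E * (\<Sum>i\<in>pool. ?\<psi> E i \<sigma>))"
    unfolding sum_distrib_left by (rule sum.swap)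
  finally have "real (card prior) * (real (K div 2 * u) * \<beta>) / (4 * real n)
      \<le> 2 * (\<Sum>\<sigma>\<in>prior. \<Sum>E\<in>Pow (pairs n). ?P \<sigma> E * (\<Sum>i\<in>pool. ?\<psi> E i \<sigma>)) / (4 * real n)"
    by (intro divide_right_mono) auto
  also have "\<dots> = (\<Sum>\<sigma>\<in>prior. \<Sum>E\<in>Pow (pairs n). ?P \<sigma> E * ((\<Sum>i\<in>pool. ?\<psi> E i \<sigma>) / (2 * real n)))"
    by (simp add: sum_divide_distrib sum_distrib_left)
  also have "\<dots> \<le> (\<Sum>\<sigma>\<in>prior. risk n K a b est \<sigma>)"
    unfolding risk_def
    by (intro sum_mono mult_left_mono expectation_mismatch_ge est nonneg)
  finally show ?thesis by simp
qed

text \<open>The worst case over the class is at least the average over the prior.\<close>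

lemma minimax_risk_ge:
  assumes sub: "prior \<subseteq> Theta0 n K eta"
    and nonneg: "\<And>\<sigma> E. 0 \<le> graph_prob n a b \<sigma> E" and "0 \<le> \<beta>"
    and \<beta>: "\<And>\<sigma> i. \<sigma> \<in> prior \<Longrightarrow> i \<in> pool \<Longrightarrow>
      \<beta> \<le> (\<Sum>E\<in>Pow (pairs n). min (graph_prob n a b \<sigma> E) (graph_prob n a b (flip i \<sigma>) E))"
  shows "real (K div 2 * u) * \<beta> / (4 * real n) \<le> minimax_risk n K a b eta"
  unfolding minimax_risk_def
proof (rule cINF_greatest)
  obtain \<sigma> where "\<sigma> \<in> prior" using prior_nonempty by auto
  then have "(\<lambda>_. return_pmf \<sigma>) \<in> estimators n K" by (auto simp: estimators_def prior_def)
  then show "estimators n K \<noteq> {}" by blast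
next
  fix est assume est: "est \<in> estimators n K"
  let ?v = "real (K div 2 * u) * \<beta> / (4 * real n)"
  have "\<exists>\<sigma>\<in>prior. ?v \<le> risk n K a b est \<sigma>"
  proof (rule ccontr)
    assume "\<not> ?thesis"
    then have "(\<Sum>\<sigma>\<in>prior. risk n K a b est \<sigma>) < (\<Sum>\<sigma>\<in>prior. ?v)"
      by (intro sum_strict_mono) (auto simp: prior_nonempty not_le)
    then show False using sum_risk_ge[OF est nonneg \<open>0 \<le> \<beta>\<close> \<beta>] by simp
  qed
  then obtain \<sigma> where \<sigma>: "\<sigma> \<in> prior" "?v \<le> risk n K a b est \<sigma>" by blast
  \<comment> \<open>Finiteness bounds the risks from above, so the real supremum really dominates
    each of them.\<close>
  have "finite (Theta0 n K eta)"
    by (rule finite_subset[OF _ finite_assignments]) (auto simp: Theta0_def)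
  then show "?v \<le> (SUP \<sigma>\<in>Theta0 n K eta. risk n K a b est \<sigma>)"
    using \<sigma> sub by (intro cSUP_upper2[of _ _ \<sigma>]) auto
qed

end

section \<open>Explicit lower bound and asymptotics\<close>

lemma affinity_le_one:
  assumes "0 < p" "p < 1" "0 < q" "q < 1"
  shows "affinity p q \<le> 1"
proof -
  have "0 \<le> (sqrt p - sqrt q)\<^sup>2 + (sqrt (1 - p) - sqrt (1 - q))\<^sup>2" by simp
  also have "\<dots> = 2 * (1 - affinity p q)"
    using assms by (simp add: power2_diff affinity_def real_sqrt_mult)
  finally show ?thesis by simp
qed

text \<open>The term \<open>x\<close> is the target exponent, \<open>2 * x / X\<close> pays for
  surplus edges, and the square root for the fluctuation of the log-likelihood ratio. Both
  corrections are of smaller order than \<open>x\<close> when \<open>x\<close> and \<open>X\<close>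
  tend to infinity.\<close>

lemma minimax_risk_lower_bound:
  fixes n K :: nat and a b eta eps0 :: real
  defines "X \<equiv> real n / real K" and "x \<equiv> real n * I_div n a b / real K"
  assumes K: "2 \<le> K" and X: "8 \<le> X" and eps0: "0 < eps0"
    and ab: "0 < b" "b < a" and a: "a / real n < 1 - eps0"
    and eta: "2 * real K / real n \<le> eta"
  shows "exp (- (x + 2 * x / X + sqrt (5 * x / eps0))) / 48 \<le> minimax_risk n K a b eta" "0 \<le> x"
proof -
  define p where "p = a / real n"
  define q where "q = b / real n"
  define B where "B = affinity p q"
  define I where "I = I_div n a b"
  define Q where "Q = n div K"
  \<comment> \<open>The largest \<open>u\<close> with \<open>2 * u + 1 \<le> Q\<close>, so that
    nearly half of each paired residue class lies in the pool.\<close>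
  define u where "u = (Q - 1) div 2"
  have K0: "0 < real K" using K by simp
  have n: "0 < real n" using X K0 by (cases "n = 0") (auto simp: X_def)
  have pq: "0 < p" "p < 1" "0 < q" "q < 1" and pe: "p < 1 - eps0" "q < 1 - eps0"
  proof -
    have "q < p" "0 < q" using ab n by (auto simp: p_def q_def divide_strict_right_mono)
    then show "0 < p" "p < 1" "0 < q" "q < 1" "p < 1 - eps0" "q < 1 - eps0"
      using a eps0 unfolding p_def[symmetric] by linarith+
  qed
  have B: "0 < B" "B \<le> 1" using affinity_pos affinity_le_one pq by (auto simp: B_def)
  have I: "I = - 2 * ln B" by (simp add: I_def I_div_def B_def affinity_def p_def q_def)
  then have I0: "0 \<le> I" using B by simp
  have x: "x = X * I" by (simp add: x_def X_def I_def)
  then show x0: "0 \<le> x" using I0 X by simp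
  \<comment> \<open>The gap between \<open>a / n\<close> and 1 keeps the non-edge part of the
    affinity at least \<open>eps0\<close>, so division by \<open>B\<close> costs a constant.\<close>
  have "eps0 * eps0 \<le> (1 - p) * (1 - q)" using pe eps0 by (intro mult_mono) auto
  then have "eps0 \<le> sqrt ((1 - p) * (1 - q))" by (intro real_le_rsqrt) (simp add: power2_eq_square)
  then have Be: "eps0 \<le> B" unfolding B_def affinity_def using pq
    by (intro add_increasing) auto
  have W: "8 * (1 - B) / B \<le> 4 * I / eps0"
  proof -
    have "1 - B \<le> I / 2" using ln_le_minus_one[OF B(1)] by (simp add: I)
    then show ?thesis using B Be eps0 I0 by (intro frac_le) auto
  qed
  have "real n = real Q * real K + real (n mod K)"
    unfolding Q_def by (metis div_mult_mod_eq of_nat_add of_nat_mult)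
  moreover have "real (n mod K) < real K" using K by simp
  ultimately have Q: "real Q \<le> X" "X < real Q + 1"
    using K0 unfolding X_def by (auto simp: field_simps)
  then have "7 < real Q" using X by linarith
  then have Q7: "7 < Q" by simp
  interpret sbm_prior n K u
    using K Q7 by unfold_locales (auto simp: u_def Q_def[symmetric])
  define \<beta> where "\<beta> = B ^ (2 * Q + 3) * exp (- sqrt ((2 * real Q + 19) * (4 * I / eps0)) / 2)"
  have "exp (- (x + 2 * x / X + sqrt (5 * x / eps0))) \<le> \<beta>"
  proof -
    have "B ^ (2 * Q + 3) = exp (real (2 * Q + 3) * ln B)"
      using B by (simp add: exp_of_nat_mult del: of_nat_add of_nat_mult)
    also have "real (2 * Q + 3) * ln B = - ((real Q + 3 / 2) * I)"
      by (simp add: I algebra_simps)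
    finally have "\<beta> = exp (- ((real Q + 3 / 2) * I + sqrt ((2 * real Q + 19) * (4 * I / eps0)) / 2))"
      by (simp add: \<beta>_def exp_add[symmetric])
    moreover have "(real Q + 3 / 2) * I \<le> (X + 2) * I"
      using Q I0 by (intro mult_right_mono) auto
    moreover have "(X + 2) * I = x + 2 * x / X"
      using X by (simp add: x field_simps)
    moreover have "sqrt ((2 * real Q + 19) * (4 * I / eps0)) / 2 \<le> sqrt (5 * x / eps0)"
    proof -
      \<comment> \<open>From \<open>Q \<le> X\<close> and \<open>8 \<le> X\<close> follows
        \<open>2 * Q + 19 \<le> 5 * X\<close>.\<close>
      have "(2 * real Q + 19) * (4 * I / eps0) \<le> (5 * X) * (4 * I / eps0)"
        using Q X I0 eps0 by (intro mult_right_mono) auto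
      also have "\<dots> = 4 * (5 * x / eps0)" by (simp add: x)
      finally have "sqrt ((2 * real Q + 19) * (4 * I / eps0)) \<le> sqrt (4 * (5 * x / eps0))"
        by (rule real_sqrt_le_mono)
      also have "\<dots> = 2 * sqrt (5 * x / eps0)" by (simp only: real_sqrt_mult real_sqrt_four)
      finally show ?thesis by simp
    qed
    ultimately show ?thesis by simp
  qed
  \<comment> \<open>\<open>K div 2\<close> is at least \<open>K / 3\<close>, attained at
    \<open>K = 3\<close>, and \<open>8 \<le> X\<close> gives \<open>u \<ge> X / 4\<close>. So at
    least a twelfth of all nodes can flip, and 48 is 4 times 12.\<close>
  moreover have "1 / 48 \<le> real (K div 2 * u) / (4 * real n)"
  proof -
    have "Q \<le> 2 * u + 2" unfolding u_def by linarith
    then have "real Q \<le> 2 * real u + 2" by linarith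
    then have u: "X / 4 \<le> real u" using Q X by linarith
    have "K \<le> 3 * (K div 2)" using K by linarith
    then have "real K / 3 \<le> real (K div 2)" by linarith
    then have "(real K / 3) * (X / 4) \<le> real (K div 2) * real u"
      using u X K0 by (intro mult_mono) auto
    moreover have "(real K / 3) * (X / 4) = real n / 12" using K0 by (simp add: X_def)
    ultimately show ?thesis using n by (simp add: field_simps)
  qed
  moreover have "0 \<le> \<beta>" using B by (simp add: \<beta>_def)
  ultimately have "exp (- (x + 2 * x / X + sqrt (5 * x / eps0))) * (1 / 48)
      \<le> \<beta> * (real (K div 2 * u) / (4 * real n))"
    by (intro mult_mono) auto
  also have "\<dots> \<le> minimax_risk n K a b eta"
  proof -
    have "\<beta> \<le> (\<Sum>E\<in>Pow (pairs n). min (graph_prob n a b \<sigma> E) (graph_prob n a b (flip i \<sigma>) E))"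
      if "\<sigma> \<in> prior" "i \<in> pool" for \<sigma> i
      unfolding \<beta>_def Q_def
      by (rule sum_min_flip_ge[OF that pq[unfolded p_def q_def] B_def[unfolded p_def q_def] B(2) W])
    from minimax_risk_ge[OF prior_subset_Theta0[OF eta] graph_prob_nonneg \<open>0 \<le> \<beta>\<close> this]
    show ?thesis using pq by (simp add: p_def q_def mult.commute)
  qed
  finally show "exp (- (x + 2 * x / X + sqrt (5 * x / eps0))) / 48 \<le> minimax_risk n K a b eta"
    by simp
qed

theorem theorem3:
  fixes eps0 :: real and K :: "nat \<Rightarrow> nat" and a b eta :: "nat \<Rightarrow> real"
  assumes eps0_pos: "eps0 > 0"
    and K_ge: "\<forall>n. K n \<ge> 2"
    and ab: "\<forall>n. eps0 < b n \<and> b n < a n"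
    and a_small: "\<forall>n\<ge>1. a n / real n < 1 - eps0"
    and eta_lim: "eta \<longlonglongrightarrow> 0"
    and eta_ge: "\<forall>n\<ge>1. eta n \<ge> 2 * real (K n) / real n"
  shows "(filterlim (\<lambda>n. real n * I_div n (a n) (b n) / real (K n)) at_top sequentially \<longrightarrow>
           (\<exists>\<delta>::nat \<Rightarrow> real. \<delta> \<longlonglongrightarrow> 0 \<and>
              (\<forall>\<^sub>F n in sequentially. minimax_risk n (K n) (a n) (b n) (eta n) \<ge>
                 exp (- (1 + \<delta> n) * (real n * I_div n (a n) (b n) / real (K n))))))
       \<and> ((\<lambda>n. real n * I_div n (a n) (b n) / real (K n)) \<in> O(\<lambda>_. 1) \<longrightarrow>
           (\<exists>c>0. \<forall>\<^sub>F n in sequentially. minimax_risk n (K n) (a n) (b n) (eta n) \<ge> c))"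
proof -
  define x where "x n = real n * I_div n (a n) (b n) / real (K n)" for n
  define X where "X n = real n / real (K n)" for n
  define R where "R n = minimax_risk n (K n) (a n) (b n) (eta n)" for n
  have K0: "0 < real (K n)" for n using K_ge[rule_format, of n] by simp
  \<comment> \<open>Since \<open>2 * K n / n \<le> eta n\<close>, a vanishing \<open>eta\<close>
    forces \<open>n / K n\<close> to grow; the value 1/4 yields \<open>8 \<le> X n\<close>.\<close>
  have "\<forall>\<^sub>F n in sequentially. eta n < 1 / 4" using eta_lim by (rule order_tendstoD) simp
  then have bound: "\<forall>\<^sub>F n in sequentially. 8 \<le> X n \<and> 0 \<le> x n \<and>
      exp (- (x n + 2 * x n / X n + sqrt (5 * x n / eps0))) / 48 \<le> R n"
    using eventually_ge_at_top[of 1]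
  proof eventually_elim
    case (elim n)
    have "2 * real (K n) / real n \<le> eta n" using eta_ge elim by simp
    then have "2 * real (K n) / real n \<le> 1 / 4" using elim by linarith
    then have X: "8 \<le> X n" using K0[of n] elim by (simp add: X_def field_simps)
    have "0 < b n" using ab eps0_pos by (meson order.strict_trans)
    then show ?case
      using minimax_risk_lower_bound[of "K n" n eps0 "b n" "a n" "eta n"]
        X K_ge eps0_pos ab a_small eta_ge elim
      by (simp add: X_def x_def R_def)
  qed
  have "\<exists>\<delta>. \<delta> \<longlonglongrightarrow> 0 \<and> (\<forall>\<^sub>F n in sequentially. R n \<ge> exp (- (1 + \<delta> n) * x n))"
    if x: "filterlim x at_top sequentially"
  proof (intro exI conjI)
    \<comment> \<open>The corrections of the explicit bound divided by \<open>x n\<close>; the last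
      term absorbs the factor \<open>1 / 48\<close>.\<close>
    define \<delta> where "\<delta> n = 2 / X n + sqrt (5 / eps0) / sqrt (x n) + ln 48 / x n" for n
    have inv: "(\<lambda>n. 2 / X n) \<longlonglongrightarrow> 0"
    proof (rule tendsto_sandwich[OF _ _ tendsto_const eta_lim])
      show "\<forall>\<^sub>F n in sequentially. 0 \<le> 2 / X n" by (simp add: X_def)
      show "\<forall>\<^sub>F n in sequentially. 2 / X n \<le> eta n"
        using eventually_ge_at_top[of 1] by eventually_elim (use eta_ge in \<open>simp add: X_def\<close>)
    qed
    have "(\<lambda>n. sqrt (5 / eps0) / sqrt (x n)) \<longlonglongrightarrow> 0"
      by (intro tendsto_divide_0[OF tendsto_const] filterlim_at_top_imp_at_infinity
          filterlim_compose[OF sqrt_at_top x])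
    moreover have "(\<lambda>n. ln 48 / x n) \<longlonglongrightarrow> 0"
      by (intro tendsto_divide_0[OF tendsto_const] filterlim_at_top_imp_at_infinity x)
    ultimately have "(\<lambda>n. 2 / X n + sqrt (5 / eps0) / sqrt (x n) + ln 48 / x n) \<longlonglongrightarrow> 0 + 0 + 0"
      by (intro tendsto_add inv)
    then show "\<delta> \<longlonglongrightarrow> 0" by (simp add: \<delta>_def[abs_def])
    have "\<forall>\<^sub>F n in sequentially. 0 < x n" using x by (simp add: filterlim_at_top_dense)
    with bound show "\<forall>\<^sub>F n in sequentially. R n \<ge> exp (- (1 + \<delta> n) * x n)"
    proof eventually_elim
      case (elim n)
      have "sqrt (5 / eps0) / sqrt (x n) * x n = sqrt (5 / eps0) * sqrt (x n)"
        using elim by (simp add: field_simps)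
      also have "\<dots> = sqrt (5 * x n / eps0)" by (simp add: real_sqrt_mult[symmetric])
      finally have "(1 + \<delta> n) * x n = x n + 2 * x n / X n + sqrt (5 * x n / eps0) + ln 48"
        using elim by (simp add: \<delta>_def distrib_right)
      then have "exp (- (1 + \<delta> n) * x n) = exp (- (x n + 2 * x n / X n + sqrt (5 * x n / eps0)) - ln 48)"
        by (simp add: algebra_simps)
      also have "\<dots> = exp (- (x n + 2 * x n / X n + sqrt (5 * x n / eps0))) / 48"
        by (subst exp_diff) simp
      finally show ?case using elim by simp
    qed
  qed
  moreover have "\<exists>c>0. \<forall>\<^sub>F n in sequentially. R n \<ge> c" if x: "x \<in> O(\<lambda>_. 1)"
  proof -
    obtain C where "0 < C" and C: "\<forall>\<^sub>F n in sequentially. norm (x n) \<le> C * norm (1::real)"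
      using x by (rule landau_o.bigE)
    show ?thesis
    proof (intro exI conjI)
      \<comment> \<open>Each of the three terms of the exponent is replaced by its bound under
        \<open>x n \<le> C\<close>; the middle one is at most \<open>x n\<close> because
        \<open>X n \<ge> 2\<close>.\<close>
      show "0 < exp (- (C + C + sqrt (5 * C / eps0))) / 48" by simp
      show "\<forall>\<^sub>F n in sequentially. R n \<ge> exp (- (C + C + sqrt (5 * C / eps0))) / 48"
        using bound C
      proof eventually_elim
        case (elim n)
        have "2 * x n / X n \<le> 2 * x n / 2" using elim by (intro divide_left_mono) auto
        then have "2 * x n / X n \<le> C" using elim by simp
        moreover have "sqrt (5 * x n / eps0) \<le> sqrt (5 * C / eps0)"
          using elim eps0_pos by (simp add: divide_right_mono)
        moreover have "x n \<le> C" using elim by simp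
        ultimately have "x n + 2 * x n / X n + sqrt (5 * x n / eps0) \<le> C + C + sqrt (5 * C / eps0)"
          by (intro add_mono)
        then have "exp (- (C + C + sqrt (5 * C / eps0)))
            \<le> exp (- (x n + 2 * x n / X n + sqrt (5 * x n / eps0)))"
          by (simp only: exp_le_cancel_iff neg_le_iff_le)
        then show ?case using elim by linarith
      qed
    qed
  qed
  ultimately show ?thesis by (simp only: x_def[abs_def] R_def) blast
qed

end
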